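(* Let $L>0$ be fixed and $c\in(\pi^2/L^2,+\infty)$. Then the dnoidal wave $\phi_c(x)=\eta\,dn(\eta x;k)$ has fundamental period $L$ and satisfies $$[\phi_c']^2=-\phi_c^4+2c\phi_c^2+2B_{\phi_c}$$ for some real constant $B_{\phi_c}$. Moreover, the mapping $$c\in(\pi^2/L^2,+\infty)\mapsto\phi_c\in H^n_{per}([0,L]),\qquad n=0,1,\ldots$$ is a smooth function and the modulus $k=k(c)$ satisfies $dk/dc>0$.
   Context: $K(k)=\int_0^1\frac{dt}{\sqrt{(1-t^2)(1-k^2t^2)}}$ is the complete elliptic integral of the first kind and $dn(\cdot;k)$ is the Jacobi elliptic dnoidal function of modulus $k\in(0,1)$. The parameters of the wave are related to $c$ and $L$ by $$\eta=\frac{2K(k)}{L},\qquad c=\frac{2K(k)^2}{L^2}(2-k^2),$$ so that $k=k(c)\in(0,1)$ is the modulus determined by the second relation. $H^n_{per}([0,L])$ is the Sobolev space of order $n$ of $L$-periodic functions. *)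

theory Defs
  imports "HOL-Analysis.Analysis" "HOL-Library.Periodic_Fun"
begin

text \<open>Elliptic integrals and the dnoidal function, all in terms of the modulus k.
  The interval integral is oriented, so \<open>ellip_F k\<close> is an odd function of the amplitude.\<close>

definition ellip_K :: "real \<Rightarrow> real" where
  "ellip_K k = (LBINT t=0..1. 1 / sqrt ((1 - t\<^sup>2) * (1 - k\<^sup>2 * t\<^sup>2)))"

definition ellip_F :: "real \<Rightarrow> real \<Rightarrow> real" where
  "ellip_F k \<phi> = (LBINT \<theta>=0..\<phi>. 1 / sqrt (1 - k\<^sup>2 * (sin \<theta>)\<^sup>2))"

definition jacobi_am :: "real \<Rightarrow> real \<Rightarrow> real" where
  "jacobi_am k u = (THE \<phi>. ellip_F k \<phi> = u)"

definition jacobi_dn :: "real \<Rightarrow> real \<Rightarrow> real" where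
  "jacobi_dn k u = sqrt (1 - k\<^sup>2 * (sin (jacobi_am k u))\<^sup>2)"

definition is_modulus :: "real \<Rightarrow> real \<Rightarrow> real \<Rightarrow> bool" where
  "is_modulus L c k \<longleftrightarrow> 0 < k \<and> k < 1 \<and> c = 2 * (ellip_K k)\<^sup>2 / L\<^sup>2 * (2 - k\<^sup>2)"

definition modulus :: "real \<Rightarrow> real \<Rightarrow> real" where
  "modulus L c = (THE k. is_modulus L c k)"

definition dnoidal_eta :: "real \<Rightarrow> real \<Rightarrow> real" where
  "dnoidal_eta L c = 2 * ellip_K (modulus L c) / L"

definition dnoidal :: "real \<Rightarrow> real \<Rightarrow> real \<Rightarrow> real" where
  "dnoidal L c x = dnoidal_eta L c * jacobi_dn (modulus L c) (dnoidal_eta L c * x)"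

definition fundamental_period :: "(real \<Rightarrow> 'b) \<Rightarrow> real \<Rightarrow> bool" where
  "fundamental_period f T \<longleftrightarrow>
     0 < T \<and> periodic_fun_simple f T \<and> (\<forall>S. 0 < S \<and> S < T \<longrightarrow> \<not> periodic_fun_simple f S)"

text \<open>The Sobolev space of order n of L-periodic real functions, in its Fourier description:
  u lies in it iff u is L-periodic, square integrable over a period, and
  \<open>\<parallel>u\<parallel>\<^sup>2 = L * (\<Sum>m\<in>\<int>. (1 + m\<^sup>2)^n * \<bar>u\<^sub>m\<bar>\<^sup>2)\<close> is finite, where \<open>u\<^sub>m\<close> are the Fourier
  coefficients. Elements are Borel representatives of the almost-everywhere classes, so
  \<open>Hper_norm\<close> is a seminorm on functions which vanishes exactly on the null functions.
  It is meaningful only on \<open>Hper n L\<close>, since \<open>infsum\<close> is 0 for divergent series.\<close>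

definition fourier_coeff :: "real \<Rightarrow> (real \<Rightarrow> real) \<Rightarrow> int \<Rightarrow> complex" where
  "fourier_coeff L u m =
     (CLBINT x=0..L. complex_of_real (u x) * cis (- (2 * pi * of_int m * x / L))) / of_real L"

definition Hper_term :: "nat \<Rightarrow> real \<Rightarrow> (real \<Rightarrow> real) \<Rightarrow> int \<Rightarrow> real" where
  "Hper_term n L u m = (1 + (of_int m)\<^sup>2) ^ n * (cmod (fourier_coeff L u m))\<^sup>2"

definition Hper :: "nat \<Rightarrow> real \<Rightarrow> (real \<Rightarrow> real) set" where
  "Hper n L = {u. u \<in> borel_measurable borel \<and> periodic_fun_simple u L
      \<and> set_integrable lborel {0..L} (\<lambda>x. (u x)\<^sup>2)
      \<and> Hper_term n L u summable_on UNIV}"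

definition Hper_norm :: "nat \<Rightarrow> real \<Rightarrow> (real \<Rightarrow> real) \<Rightarrow> real" where
  "Hper_norm n L u = sqrt (L * infsum (Hper_term n L u) UNIV)"

text \<open>Curves in \<open>Hper n L\<close>: differentiability is convergence of the difference quotients in the
  norm of the space, and smoothness is the existence of derivatives of every order (each of which
  is continuous because it is itself differentiable).\<close>

definition Hper_has_deriv ::
  "nat \<Rightarrow> real \<Rightarrow> (real \<Rightarrow> real \<Rightarrow> real) \<Rightarrow> (real \<Rightarrow> real) \<Rightarrow> real \<Rightarrow> real set \<Rightarrow> bool" where
  "Hper_has_deriv n L F D c S \<longleftrightarrow>
     ((\<lambda>y. Hper_norm n L (\<lambda>x. (F y x - F c x) / (y - c) - D x)) \<longlongrightarrow> 0) (at c within S)"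

definition smooth_into_Hper :: "nat \<Rightarrow> real \<Rightarrow> real set \<Rightarrow> (real \<Rightarrow> real \<Rightarrow> real) \<Rightarrow> bool" where
  "smooth_into_Hper n L S F \<longleftrightarrow>
     (\<exists>G :: nat \<Rightarrow> real \<Rightarrow> real \<Rightarrow> real.
        (\<forall>c\<in>S. G 0 c = F c) \<and>
        (\<forall>j. \<forall>c\<in>S. G j c \<in> Hper n L \<and> Hper_has_deriv n L (G j) (G (Suc j) c) c S))"

end

theory Submission
  imports Defs
begin

text \<open>The map \<open>k \<mapsto> c = 2 K(k)\<^sup>2 (2 - k\<^sup>2) / L\<^sup>2\<close> is increasing on \<open>(0, 1)\<close> from
  \<open>\<pi>\<^sup>2 / L\<^sup>2\<close> to infinity: the integrand of \<open>(2 - k\<^sup>2) K'(k) - k K(k)\<close> is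
  \<open>k (2 sin\<^sup>2 t - 1) (1 - k\<^sup>2 sin\<^sup>2 t) powr (-3/2)\<close>, a function of mean zero multiplied by a weight
  which is larger where that function is positive. So \<open>k(c)\<close> is smooth with positive derivative.
  The amplitude is the inverse of \<open>F(k, \<cdot>)\<close>, a smooth function of two variables with positive
  derivative in the amplitude, so \<open>(c, x) \<mapsto> \<phi>\<^sub>c(x)\<close> is jointly smooth.
  Joint smoothness gives smoothness into every \<open>H\<^sup>n\<close>: integrating by parts \<open>n + 1\<close>
  times bounds the \<open>H\<^sup>n\<close> norm by the sup norms of a function and its derivative of order
  \<open>n + 1\<close>, and the difference quotients in \<open>c\<close> of all x-derivatives converge uniformly on a period.\<close>

text \<open>The amplitude and the modulus are given only as solutions of equations, and smoothness
  is asked for in a norm built from Fourier coefficients, whereas what can be computed about the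
  wave is pointwise. The predicate \<open>ck_on\<close> carries the passage: it asks for continuous
  partial derivatives up to order n with unspecified witnesses, so that closure under products,
  composition, integration and inversion follows by induction on n from one-step derivative
  formulas. In the smoothness statements the modulus ranges over (-1, 1). The elliptic integrals
  depend on k^2 only, hence cross k = 0 smoothly, and the value K(0) = pi/2 at this interior point
  produces the endpoint pi^2/L^2 of the range of speeds. K(k) is handled as F(k, pi/2): the
  substitution t = sin x removes the singularity at t = 1, and the smoothness of F passes to K. The
  combination (2 - k^2) K' - k K is studied because dc/dk is 4 K / L^2 times it and K > 0.\<close>

section \<open>Jointly smooth functions of a parameter and a real variable\<close>

text \<open>In \<open>ck_on n S f\<close> only the first argument, the parameter, is confined to \<open>S\<close>; the second
  ranges over the whole line.\<close>

primrec ck_on :: "nat \<Rightarrow> real set \<Rightarrow> (real \<Rightarrow> real \<Rightarrow> real) \<Rightarrow> bool" where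
  "ck_on 0 S f \<longleftrightarrow> continuous_on (S \<times> UNIV) (\<lambda>(s, x). f s x)"
| "ck_on (Suc n) S f \<longleftrightarrow> continuous_on (S \<times> UNIV) (\<lambda>(s, x). f s x) \<and>
     (\<exists>f1 f2. (\<forall>s\<in>S. \<forall>x. ((\<lambda>s. f s x) has_real_derivative f1 s x) (at s) \<and>
                          (f s has_real_derivative f2 s x) (at x)) \<and>
        ck_on n S f1 \<and> ck_on n S f2)"

lemma ck_on_continuous: "ck_on n S f \<Longrightarrow> continuous_on (S \<times> UNIV) (\<lambda>(s, x). f s x)"
  by (cases n) auto

lemma ck_on_SucI:
  assumes "continuous_on (S \<times> UNIV) (\<lambda>(s, x). f s x)"
    and "\<And>s x. s \<in> S \<Longrightarrow> ((\<lambda>s. f s x) has_real_derivative f1 s x) (at s)"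
    and "\<And>s x. s \<in> S \<Longrightarrow> (f s has_real_derivative f2 s x) (at x)"
    and "ck_on n S f1" "ck_on n S f2"
  shows "ck_on (Suc n) S f"
  using assms by (simp only: ck_on.simps) blast

lemma ck_on_SucE:
  assumes "ck_on (Suc n) S f"
  obtains f1 f2 where
    "\<And>s x. s \<in> S \<Longrightarrow> ((\<lambda>s. f s x) has_real_derivative f1 s x) (at s)"
    "\<And>s x. s \<in> S \<Longrightarrow> (f s has_real_derivative f2 s x) (at x)"
    "ck_on n S f1" "ck_on n S f2"
  using assms by auto

text \<open>Used to replace a function by a formula that is valid only for parameters in
  \<open>S\<close>. Openness makes the two functions agree near each parameter, so the parameter
  derivative is inherited; in the other variable \<open>f s\<close> and \<open>g s\<close> are the
  same function.\<close>

lemma ck_on_cong: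
  assumes "open S" "\<And>s x. s \<in> S \<Longrightarrow> f s x = g s x" "ck_on n S f"
  shows "ck_on n S g"
proof -
  have cont: "continuous_on (S \<times> UNIV) (\<lambda>(s, x). g s x)"
    using ck_on_continuous[OF assms(3)] assms(2)
    by (auto intro: continuous_on_eq)
  show ?thesis
  proof (cases n)
    case 0
    then show ?thesis using cont by simp
  next
    case (Suc m)
    obtain f1 f2 where f:
      "\<And>s x. s \<in> S \<Longrightarrow> ((\<lambda>s. f s x) has_real_derivative f1 s x) (at s)"
      "\<And>s x. s \<in> S \<Longrightarrow> (f s has_real_derivative f2 s x) (at x)"
      "ck_on m S f1" "ck_on m S f2"
      using assms(3) unfolding Suc by (rule ck_on_SucE) blast
    show ?thesis
      unfolding Suc
    proof (rule ck_on_SucI[OF cont _ _ f(3,4)])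
      show "((\<lambda>s. g s x) has_real_derivative f1 s x) (at s)" if "s \<in> S" for s x
        using f(1)[OF that] assms(1) that assms(2)
        by (rule has_field_derivative_transform_within_open)
      show "(g s has_real_derivative f2 s x) (at x)" if "s \<in> S" for s x
        using f(2)[OF that, of x] assms(2)[OF that] by (metis ext)
    qed
  qed
qed

lemma ck_on_Suc: "ck_on (Suc n) S f \<Longrightarrow> ck_on n S f"
proof (induction n arbitrary: f)
  case 0
  then show ?case by simp
next
  case (Suc n)
  obtain f1 f2 where f:
      "\<And>s x. s \<in> S \<Longrightarrow> ((\<lambda>s. f s x) has_real_derivative f1 s x) (at s)"
      "\<And>s x. s \<in> S \<Longrightarrow> (f s has_real_derivative f2 s x) (at x)"
      "ck_on (Suc n) S f1" "ck_on (Suc n) S f2"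
    using Suc.prems by (rule ck_on_SucE) blast
  show ?case
    using Suc.prems f by (intro ck_on_SucI[of S f f1 f2] Suc.IH) (auto intro: ck_on_continuous)
qed

lemma ck_on_const [intro]: "ck_on n S (\<lambda>s x. c)"
proof (induction n arbitrary: c)
  case (Suc n)
  then show ?case
    by (intro ck_on_SucI[where ?f1.0 = "\<lambda>_ _. 0" and ?f2.0 = "\<lambda>_ _. 0"]) auto
qed simp

lemma ck_on_fst [intro]: "ck_on n S (\<lambda>s x. s)"
proof (cases n)
  case (Suc m)
  then show ?thesis
    by (auto simp: case_prod_beta simp del: ck_on.simps intro!: continuous_intros
      ck_on_SucI[where ?f1.0 = "\<lambda>_ _. 1" and ?f2.0 = "\<lambda>_ _. 0"])
qed (auto simp: case_prod_beta intro!: continuous_intros)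

lemma ck_on_snd [intro]: "ck_on n S (\<lambda>s x. x)"
proof (cases n)
  case (Suc m)
  then show ?thesis
    by (auto simp: case_prod_beta simp del: ck_on.simps intro!: continuous_intros
      ck_on_SucI[where ?f1.0 = "\<lambda>_ _. 0" and ?f2.0 = "\<lambda>_ _. 1"])
qed (auto simp: case_prod_beta intro!: continuous_intros)

lemma ck_on_add [intro]:
  "ck_on n S f \<Longrightarrow> ck_on n S g \<Longrightarrow> ck_on n S (\<lambda>s x. f s x + g s x)"
proof (induction n arbitrary: f g)
  case 0
  then show ?case by (auto simp: case_prod_beta intro: continuous_intros)
next
  case (Suc n)
  obtain f1 f2 where f:
      "\<And>s x. s \<in> S \<Longrightarrow> ((\<lambda>s. f s x) has_real_derivative f1 s x) (at s)"
      "\<And>s x. s \<in> S \<Longrightarrow> (f s has_real_derivative f2 s x) (at x)"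
      "ck_on n S f1" "ck_on n S f2"
    using Suc.prems(1) by (rule ck_on_SucE) blast
  obtain g1 g2 where g:
      "\<And>s x. s \<in> S \<Longrightarrow> ((\<lambda>s. g s x) has_real_derivative g1 s x) (at s)"
      "\<And>s x. s \<in> S \<Longrightarrow> (g s has_real_derivative g2 s x) (at x)"
      "ck_on n S g1" "ck_on n S g2"
    using Suc.prems(2) by (rule ck_on_SucE) blast
  have "continuous_on (S \<times> UNIV) (\<lambda>(s, x). f s x + g s x)"
    using Suc.prems[THEN ck_on_continuous] by (auto simp: case_prod_beta intro: continuous_intros)
  then show ?case
    using f g Suc.IH
    by (intro ck_on_SucI[where ?f1.0 = "\<lambda>s x. f1 s x + g1 s x" and ?f2.0 = "\<lambda>s x. f2 s x + g2 s x"])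
       (auto intro!: derivative_intros)
qed

lemma ck_on_mult [intro]:
  "ck_on n S f \<Longrightarrow> ck_on n S g \<Longrightarrow> ck_on n S (\<lambda>s x. f s x * g s x)"
proof (induction n arbitrary: f g)
  case 0
  then show ?case by (auto simp: case_prod_beta intro: continuous_intros)
next
  case (Suc n)
  obtain f1 f2 where f:
      "\<And>s x. s \<in> S \<Longrightarrow> ((\<lambda>s. f s x) has_real_derivative f1 s x) (at s)"
      "\<And>s x. s \<in> S \<Longrightarrow> (f s has_real_derivative f2 s x) (at x)"
      "ck_on n S f1" "ck_on n S f2"
    using Suc.prems(1) by (rule ck_on_SucE) blast
  obtain g1 g2 where g:
      "\<And>s x. s \<in> S \<Longrightarrow> ((\<lambda>s. g s x) has_real_derivative g1 s x) (at s)"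
      "\<And>s x. s \<in> S \<Longrightarrow> (g s has_real_derivative g2 s x) (at x)"
      "ck_on n S g1" "ck_on n S g2"
    using Suc.prems(2) by (rule ck_on_SucE) blast
  have "continuous_on (S \<times> UNIV) (\<lambda>(s, x). f s x * g s x)"
    using Suc.prems[THEN ck_on_continuous] by (auto simp: case_prod_beta intro: continuous_intros)
  then show ?case
    using f g Suc.IH Suc.prems[THEN ck_on_Suc]
    by (intro ck_on_SucI[where ?f1.0 = "\<lambda>s x. f1 s x * g s x + g1 s x * f s x"
            and ?f2.0 = "\<lambda>s x. f2 s x * g s x + g2 s x * f s x"] DERIV_mult ck_on_add)
       auto
qed

text \<open>The increment splits into a step in x, controlled by the continuous \<open>f2\<close>,
  and a step in s at fixed x. \<open>blinfun_mult_right\<close> presents \<open>f2\<close> as a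
  bounded linear map, so that its continuity is continuity in operator norm.\<close>

lemma has_derivative_partials:
  fixes f :: "real \<Rightarrow> real \<Rightarrow> real"
  assumes "open S" "s \<in> S"
    and "\<And>s x. s \<in> S \<Longrightarrow> ((\<lambda>s. f s x) has_real_derivative f1 s x) (at s)"
    and "\<And>s x. s \<in> S \<Longrightarrow> (f s has_real_derivative f2 s x) (at x)"
    and "continuous_on (S \<times> UNIV) (\<lambda>(s, x). f2 s x)"
  shows "((\<lambda>(s, x). f s x) has_derivative (\<lambda>(h, k). f1 s x * h + f2 s x * k)) (at (s, x))"
proof -
  have op: "open (S \<times> (UNIV :: real set))"
    using assms(1) by (simp add: open_Times)
  have "isCont (\<lambda>p. f2 (fst p) (snd p)) (s, x)"
    using assms(5) op \<open>s \<in> S\<close> by (auto simp: continuous_on_eq_continuous_at case_prod_beta)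
  then have "isCont (\<lambda>p. blinfun_mult_right (f2 (fst p) (snd p))) (s, x)"
    by (rule bounded_linear.isCont[OF bounded_linear_blinfun_mult_right])
  then have cont: "continuous (at (s, x) within S \<times> UNIV) (\<lambda>(s, x). blinfun_mult_right (f2 s x))"
    unfolding case_prod_beta by (rule continuous_at_imp_continuous_within)
  have "((\<lambda>(s, x). f s x) has_derivative
      (\<lambda>(h, k). (\<lambda>h. f1 s x * h) h + blinfun_mult_right (f2 s x) k)) (at (s, x) within S \<times> UNIV)"
  proof (rule has_derivative_partialsI[OF _ _ cont])
    show "((\<lambda>s. f s x) has_derivative (*) (f1 s x)) (at s within S)"
      using assms(3)[OF \<open>s \<in> S\<close>, of x]
      by (simp add: has_field_derivative_def has_derivative_at_withinI)
    show "(f s has_derivative blinfun_apply (blinfun_mult_right (f2 s x))) (at x within UNIV)"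
      if "s \<in> S" for s x
      using assms(4)[OF that, of x] by (simp add: has_field_derivative_def)
  qed auto
  then show ?thesis
    using op \<open>s \<in> S\<close> by (subst (asm) at_within_open) auto
qed

text \<open>By the chain rule each partial derivative is a sum of products of \<open>f1\<close> or
  \<open>f2\<close>, taken at (u, v), with a derivative of \<open>u\<close> or \<open>v\<close>. The
  induction hypothesis covers the composed factors, and the sum and product rules do the
  rest.\<close>

lemma ck_on_compose:
  assumes "open S" "ck_on n S f" "ck_on n T u" "ck_on n T v"
    and "\<And>t x. t \<in> T \<Longrightarrow> u t x \<in> S"
  shows "ck_on n T (\<lambda>t x. f (u t x) (v t x))"
  using assms(2-5)
proof (induction n arbitrary: f u v)
  case 0
  have "continuous_on (T \<times> UNIV) (\<lambda>p. (\<lambda>(s, x). f s x) (u (fst p) (snd p), v (fst p) (snd p)))"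
    by (rule continuous_on_compose2[of "S \<times> UNIV"])
       (use 0 in \<open>auto simp: case_prod_beta intro!: continuous_intros\<close>)
  then show ?case by (simp add: case_prod_beta)
next
  case (Suc n)
  obtain f1 f2 where f:
      "\<And>s x. s \<in> S \<Longrightarrow> ((\<lambda>s. f s x) has_real_derivative f1 s x) (at s)"
      "\<And>s x. s \<in> S \<Longrightarrow> (f s has_real_derivative f2 s x) (at x)"
      "ck_on n S f1" "ck_on n S f2"
    using Suc.prems(1) by (rule ck_on_SucE) blast
  obtain u1 u2 where u:
      "\<And>s x. s \<in> T \<Longrightarrow> ((\<lambda>s. u s x) has_real_derivative u1 s x) (at s)"
      "\<And>s x. s \<in> T \<Longrightarrow> (u s has_real_derivative u2 s x) (at x)"
      "ck_on n T u1" "ck_on n T u2"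
    using Suc.prems(2) by (rule ck_on_SucE) blast
  obtain v1 v2 where v:
      "\<And>s x. s \<in> T \<Longrightarrow> ((\<lambda>s. v s x) has_real_derivative v1 s x) (at s)"
      "\<And>s x. s \<in> T \<Longrightarrow> (v s has_real_derivative v2 s x) (at x)"
      "ck_on n T v1" "ck_on n T v2"
    using Suc.prems(3) by (rule ck_on_SucE) blast
  have total: "((\<lambda>(s, x). f s x) has_derivative (\<lambda>(h, k). f1 s x * h + f2 s x * k)) (at (s, x))"
    if "s \<in> S" for s x
    using assms(1) that f(1,2) ck_on_continuous[OF f(4)] by (rule has_derivative_partials)
  have chain: "((\<lambda>y. f (a y) (b y)) has_real_derivative f1 (a y) (b y) * a' + f2 (a y) (b y) * b') (at y)"
    if "(a has_real_derivative a') (at y)" "(b has_real_derivative b') (at y)" "a y \<in> S" for a b a' b' y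
  proof -
    have "((\<lambda>y. (a y, b y)) has_derivative (\<lambda>h. (a' * h, b' * h))) (at y)"
      using that(1,2) by (auto simp: has_field_derivative_def intro!: has_derivative_Pair)
    from has_derivative_compose[OF this total[OF that(3)]]
    have "((\<lambda>y. f (a y) (b y)) has_derivative
        (\<lambda>h. f1 (a y) (b y) * (a' * h) + f2 (a y) (b y) * (b' * h))) (at y)"
      by simp
    then show ?thesis
      unfolding has_field_derivative_def
      by (rule has_derivative_eq_rhs) (auto simp: algebra_simps)
  qed
  have lower: "ck_on n T (\<lambda>t x. g (u t x) (v t x))" if "ck_on n S g" for g
    using that Suc.prems(2,3)[THEN ck_on_Suc] Suc.prems(4) by (rule Suc.IH)
  have "continuous_on (T \<times> UNIV) (\<lambda>p. (\<lambda>(s, x). f s x) (u (fst p) (snd p), v (fst p) (snd p)))"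
    by (rule continuous_on_compose2[of "S \<times> UNIV"])
       (use Suc.prems(1-3)[THEN ck_on_continuous] Suc.prems(4) in \<open>auto simp: case_prod_beta intro!: continuous_intros\<close>)
  then have cont: "continuous_on (T \<times> UNIV) (\<lambda>(t, x). f (u t x) (v t x))"
    by (simp add: case_prod_beta)
  show ?case
  proof (rule ck_on_SucI[OF cont])
    show "((\<lambda>t. f (u t x) (v t x)) has_real_derivative
        f1 (u t x) (v t x) * u1 t x + f2 (u t x) (v t x) * v1 t x) (at t)" if "t \<in> T" for t x
      using u(1)[OF that] v(1)[OF that] Suc.prems(4)[OF that] by (rule chain)
    show "((\<lambda>x. f (u t x) (v t x)) has_real_derivative
        f1 (u t x) (v t x) * u2 t x + f2 (u t x) (v t x) * v2 t x) (at x)" if "t \<in> T" for t x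
      using u(2)[OF that] v(2)[OF that] Suc.prems(4)[OF that] by (rule chain)
  qed (auto intro!: lower f u v)
qed

text \<open>The induction runs over all exponents at once, since each differentiation lowers the
  exponent by one. The power is first treated as a function of the parameter alone and then composed
  with \<open>u\<close>.\<close>

lemma ck_on_powr:
  assumes "ck_on n T u" "\<And>t x. t \<in> T \<Longrightarrow> u t x > 0"
  shows "ck_on n T (\<lambda>t x. u t x powr a)"
proof -
  have "ck_on n {0<..} (\<lambda>s x. s powr a)"
  proof (induction n arbitrary: a)
    case 0
    then show ?case by (auto simp: case_prod_beta intro!: continuous_intros)
  next
    case (Suc n)
    have "ck_on n {0<..} (\<lambda>s x. a * s powr (a - 1))"
      by (intro ck_on_mult ck_on_const Suc)
    then show ?case
      by (intro ck_on_SucI[where ?f1.0 = "\<lambda>s x. a * s powr (a - 1)" and ?f2.0 = "\<lambda>s x. 0"])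
         (auto simp: case_prod_beta intro!: continuous_intros derivative_eq_intros)
  qed
  from ck_on_compose[OF _ this assms(1) ck_on_const] assms(2) show ?thesis
    by auto
qed

lemma ck_on_sin:
  assumes "ck_on n T u"
  shows "ck_on n T (\<lambda>t x. sin (u t x))"
proof -
  \<comment> \<open>Sine and cosine are each other's derivatives up to sign, so they go through the
    induction as a pair.\<close>
  have "ck_on n UNIV (\<lambda>s x. sin s) \<and> ck_on n UNIV (\<lambda>s x. cos s)"
  proof (induction n)
    case 0
    then show ?case by (auto simp: case_prod_beta intro!: continuous_intros)
  next
    case (Suc n)
    have "ck_on n UNIV (\<lambda>s x. (-1) * sin s)"
      using Suc by (intro ck_on_mult ck_on_const) auto
    then have "ck_on n UNIV (\<lambda>s x. - sin s)"
      by simp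
    then show ?case
      using Suc
      by (intro conjI ck_on_SucI[where f = "\<lambda>s x. sin s" and ?f1.0 = "\<lambda>s x. cos s" and ?f2.0 = "\<lambda>s x. 0"]
          ck_on_SucI[where f = "\<lambda>s x. cos s" and ?f1.0 = "\<lambda>s x. - sin s" and ?f2.0 = "\<lambda>s x. 0"])
         (auto simp: case_prod_beta intro!: continuous_intros derivative_eq_intros)
  qed
  then show ?thesis
    using ck_on_compose[OF open_UNIV _ assms ck_on_const] by auto
qed

lemma ck_on_inverse:
  assumes "ck_on n T u" "\<And>t x. t \<in> T \<Longrightarrow> u t x > 0"
  shows "ck_on n T (\<lambda>t x. 1 / u t x)"
proof -
  have "ck_on n {0<..} (\<lambda>s x. 1 / s)"
    by (rule ck_on_cong[OF _ _ ck_on_powr[OF ck_on_fst, where a = "-1"]])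
       (auto simp: powr_minus field_simps)
  from ck_on_compose[OF _ this assms(1) ck_on_const] assms(2) show ?thesis
    by auto
qed

section \<open>Integrals with a moving endpoint and a parameter\<close>

text \<open>The substitution moves the variable endpoint into the integrand, so continuity and
  differentiation can be studied on the fixed interval [0, 1]. Orientation of the interval integral
  makes it correct for negative x too.\<close>

lemma interval_integral_scale:
  fixes g :: "real \<Rightarrow> real"
  assumes "continuous_on UNIV g"
  shows "(LBINT t=0..x. g t) = integral {0..1} (\<lambda>t. x * g (x * t))"
proof -
  have "(LBINT t=ereal 0..ereal 1. x *\<^sub>R g (x * t)) = (LBINT y=ereal (x * 0)..ereal (x * 1). g y)"
    by (rule interval_integral_substitution_finite)
       (auto intro!: derivative_eq_intros continuous_intros continuous_on_subset[OF assms])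
  moreover have "continuous_on {0..1} (\<lambda>t. x * g (x * t))"
    by (intro continuous_intros continuous_on_compose2[OF assms]) auto
  then have "(LBINT t=ereal 0..ereal 1. x * g (x * t)) = integral {0..1} (\<lambda>t. x * g (x * t))"
    by (intro interval_integral_eq_integral borel_integrable_atLeastAtMost') auto
  ultimately show ?thesis
    by (simp add: zero_ereal_def)
qed

lemma interval_integral_has_derivative:
  fixes g :: "real \<Rightarrow> real"
  assumes "continuous_on UNIV g"
  shows "((\<lambda>x. LBINT t=0..x. g t) has_real_derivative g x) (at x)"
proof -
  define b where "b = \<bar>x\<bar> + 1"
  have "((\<lambda>x. LBINT t=ereal 0..ereal x. g t) has_vector_derivative g x) (at x within {-b..b})"
    by (rule interval_integral_FTC2) (auto simp: b_def intro: continuous_on_subset[OF assms])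
  moreover have "at x within {-b..b} = at x"
    by (rule at_within_interior) (auto simp: b_def)
  ultimately show ?thesis
    by (simp add: has_real_derivative_iff_has_vector_derivative zero_ereal_def)
qed

lemma continuous_on_section:
  assumes "continuous_on (S \<times> UNIV) (\<lambda>(s, x). f s x)" "s \<in> S"
  shows "continuous_on A (f s)"
proof -
  have "continuous_on A (\<lambda>x. (\<lambda>(s, x). f s x) (s, x))"
    by (rule continuous_on_compose2[OF assms(1)]) (use assms(2) in \<open>auto intro!: continuous_intros\<close>)
  then show ?thesis by simp
qed

lemma interval_integral_has_derivative_param:
  fixes f :: "real \<Rightarrow> real \<Rightarrow> real" and x :: real
  assumes "open S" "s \<in> S"
    and f1: "\<And>s x. s \<in> S \<Longrightarrow> ((\<lambda>s. f s x) has_real_derivative f1 s x) (at s)"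
    and cont: "continuous_on (S \<times> UNIV) (\<lambda>(s, x). f s x)"
    and cont1: "continuous_on (S \<times> UNIV) (\<lambda>(s, x). f1 s x)"
  shows "((\<lambda>s. LBINT t=0..x. f s t) has_real_derivative (LBINT t=0..x. f1 s t)) (at s)"
proof -
  \<comment> \<open>Leibniz's rule is stated for a convex parameter set; a ball inside
    \<open>S\<close> provides one.\<close>
  obtain r where r: "r > 0" "ball s r \<subseteq> S"
    using assms(1,2) openE by blast
  have "((\<lambda>s. integral (cbox 0 1) (\<lambda>t. x * f s (x * t))) has_field_derivative
      integral (cbox 0 1) (\<lambda>t. x * f1 s (x * t))) (at s within ball s r)"
  proof (rule leibniz_rule_field_derivative)
    show "((\<lambda>s. x * f s (x * t)) has_real_derivative x * f1 s' (x * t)) (at s' within ball s r)"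
      if "s' \<in> ball s r" for s' t
      using that r(2) by (intro DERIV_cmult has_field_derivative_at_within[OF f1]) auto
    show "(\<lambda>t. x * f s' (x * t)) integrable_on cbox 0 1" if "s' \<in> ball s r" for s'
    proof -
      have "continuous_on UNIV (f s')"
        using continuous_on_section[OF cont] that r(2) by blast
      then have "continuous_on (cbox 0 1) (\<lambda>t. f s' (x * t))"
        by (rule continuous_on_compose2) (auto intro: continuous_intros)
      then show ?thesis
        by (intro integrable_continuous continuous_on_mult continuous_on_const)
    qed
    have "continuous_on (ball s r \<times> cbox 0 1) (\<lambda>p. x * (\<lambda>(s, x). f1 s x) (fst p, x * snd p))"
      by (intro continuous_intros continuous_on_compose2[OF cont1]) (use r(2) in auto)
    then show "continuous_on (ball s r \<times> cbox 0 1) (\<lambda>(s, t). x * f1 s (x * t))"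
      by (simp add: case_prod_beta)
  qed (use r in auto)
  then have D: "((\<lambda>s. integral {0..1} (\<lambda>t. x * f s (x * t))) has_field_derivative
      integral {0..1} (\<lambda>t. x * f1 s (x * t))) (at s)"
    using r(1) by (simp add: at_within_open[of s "ball s r"])
  have eq: "integral {0..1} (\<lambda>t. x * g s' (x * t)) = (LBINT t=0..x. g s' t)"
    if "continuous_on (S \<times> UNIV) (\<lambda>(s, x). g s x)" "s' \<in> S" for g s'
    using interval_integral_scale[OF continuous_on_section[OF that]] by simp
  show ?thesis
    using has_field_derivative_transform_within_open[OF D assms(1,2) eq[OF cont]]
    by (simp only: eq[OF cont1 assms(2)])
qed

text \<open>The parameter derivative is an integral of the same kind, with \<open>f1\<close> in
  place of \<open>f\<close>, and is covered by the induction hypothesis; the derivative in the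
  endpoint is \<open>f\<close> itself.\<close>

lemma ck_on_interval_integral:
  assumes "open S" "ck_on n S f"
  shows "ck_on n S (\<lambda>s x. LBINT t=0..x. f s t)"
  using assms(2)
proof (induction n arbitrary: f)
  have cont: "continuous_on (S \<times> UNIV) (\<lambda>(s, x :: real). LBINT t=0..x. f s t)"
    if "continuous_on (S \<times> UNIV) (\<lambda>(s, x). f s x)" for f :: "real \<Rightarrow> real \<Rightarrow> real"
  proof -
    have "continuous_on ((S \<times> UNIV) \<times> cbox 0 1)
       (\<lambda>p. snd (fst p) * (\<lambda>(s, x). f s x) (fst (fst p), snd (fst p) * snd p))"
      by (intro continuous_intros continuous_on_compose2[OF that]) auto
    then have "continuous_on (S \<times> UNIV) (\<lambda>q. integral (cbox 0 1) (\<lambda>t. snd q * f (fst q) (snd q * t)))"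
      by (intro integral_continuous_on_param) (simp add: case_prod_beta)
    then show ?thesis
      unfolding split_def
      by (rule continuous_on_eq) (auto simp: interval_integral_scale[OF continuous_on_section[OF that]])
  qed
  {
    case 0
    then show ?case using cont by simp
  next
    case (Suc n)
    obtain f1 f2 where f:
      "\<And>s x. s \<in> S \<Longrightarrow> ((\<lambda>s. f s x) has_real_derivative f1 s x) (at s)"
      "\<And>s x. s \<in> S \<Longrightarrow> (f s has_real_derivative f2 s x) (at x)"
      "ck_on n S f1" "ck_on n S f2"
      using Suc.prems by (rule ck_on_SucE) blast
    note c = ck_on_continuous[OF Suc.prems]
    show ?case
    proof (rule ck_on_SucI[OF cont[OF c]])
      show "((\<lambda>s. LBINT t=0..x. f s t) has_real_derivative (LBINT t=0..x. f1 s t)) (at s)"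
        if "s \<in> S" for s and x :: real
        using assms(1) that f(1) c ck_on_continuous[OF f(3)]
        by (rule interval_integral_has_derivative_param)
      show "((\<lambda>x. LBINT t=0..x. f s t) has_real_derivative f s x) (at x)" if "s \<in> S" for s x
        by (rule interval_integral_has_derivative[OF continuous_on_section[OF c that]])
    qed (use Suc.IH[OF f(3)] ck_on_Suc[OF Suc.prems] in auto)
  }
qed

text \<open>Writing \<open>f\<close> as an integral of its second partial derivative and differentiating under
  the integral gives the symmetry of mixed derivatives.\<close>

lemma mixed_partials_eq:
  assumes "open S"
    and f1: "\<And>s x. s \<in> S \<Longrightarrow> ((\<lambda>s. f s x) has_real_derivative f1 s x) (at s)"
    and f2: "\<And>s x. s \<in> S \<Longrightarrow> (f s has_real_derivative f2 s x) (at x)"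
    and f21: "\<And>s x. s \<in> S \<Longrightarrow> ((\<lambda>s. f2 s x) has_real_derivative f21 s x) (at s)"
    and cont2: "continuous_on (S \<times> UNIV) (\<lambda>(s, x). f2 s x)"
    and cont21: "continuous_on (S \<times> UNIV) (\<lambda>(s, x). f21 s x)"
    and "s \<in> S"
  shows "(f1 s has_real_derivative f21 s x) (at x)"
proof -
  have rep: "f s x = f s 0 + (LBINT t=0..x. f2 s t)" if "s \<in> S" for s x
  proof -
    have "(LBINT t=ereal 0..ereal x. f2 s t) = f s x - f s 0"
    proof (rule interval_integral_FTC_finite)
      show "continuous_on {min 0 x..max 0 x} (f2 s)"
        by (rule continuous_on_section[OF cont2 that])
      show "(f s has_vector_derivative f2 s y) (at y within {min 0 x..max 0 x})" for y
        by (rule has_vector_derivative_at_within)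
           (rule f2[OF that, unfolded has_real_derivative_iff_has_vector_derivative])
    qed
    then show ?thesis by (simp add: zero_ereal_def)
  qed
  define g where "g = (\<lambda>x. f1 s 0 + (LBINT t=0..x. f21 s t))"
  have "f1 s x = g x" for x
  proof -
    have "((\<lambda>s. f s 0 + (LBINT t=0..x. f2 s t)) has_real_derivative
        f1 s 0 + (LBINT t=0..x. f21 s t)) (at s)"
      by (intro DERIV_add f1[OF \<open>s \<in> S\<close>]
          interval_integral_has_derivative_param[OF assms(1) \<open>s \<in> S\<close> f21 cont2 cont21])
    then have "((\<lambda>s. f s x) has_real_derivative f1 s 0 + (LBINT t=0..x. f21 s t)) (at s)"
      by (rule has_field_derivative_transform_within_open[OF _ assms(1) \<open>s \<in> S\<close>]) (rule rep[symmetric])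
    then show ?thesis
      unfolding g_def by (rule DERIV_unique[OF f1[OF \<open>s \<in> S\<close>]])
  qed
  then have "f1 s = g" ..
  moreover have "(g has_real_derivative f21 s x) (at x)"
    unfolding g_def using DERIV_add[OF DERIV_const
      interval_integral_has_derivative[OF continuous_on_section[OF cont21 \<open>s \<in> S\<close>]]]
    by simp
  ultimately show ?thesis
    by (simp only:)
qed

section \<open>Implicitly defined functions\<close>

lemma isCont_strip:
  assumes "open S" "continuous_on (S \<times> UNIV) f" "s \<in> S"
  shows "isCont f (s, x :: real)"
  using assms by (simp add: continuous_on_eq_continuous_at open_Times)

text \<open>By monotonicity a < A s x means H s a < x, which is an open condition on (s, x) because
  \<open>H\<close> is continuous; the same holds for upper bounds.\<close>

lemma continuous_on_implicit:
  fixes H A :: "real \<Rightarrow> real \<Rightarrow> real"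
  assumes "open S"
    and cont: "continuous_on (S \<times> UNIV) (\<lambda>(s, x). H s x)"
    and mono: "\<And>s. s \<in> S \<Longrightarrow> strict_mono (H s)"
    and inv: "\<And>s x. s \<in> S \<Longrightarrow> H s (A s x) = x"
  shows "continuous_on (S \<times> UNIV) (\<lambda>(s, x). A s x)"
proof -
  have op: "open (S \<times> (UNIV :: real set))"
    using assms(1) by (simp add: open_Times)
  have "((\<lambda>p. A (fst p) (snd p)) \<longlongrightarrow> A s x) (at (s, x))" if "s \<in> S" for s x
  proof (rule order_tendstoI)
    have ev: "\<forall>\<^sub>F p in at (s, x). fst p \<in> S"
      using eventually_at_in_open'[OF op, of "(s, x)"] that by (auto elim!: eventually_mono)
    have lim: "((\<lambda>p. H (fst p) a) \<longlongrightarrow> H s a) (at (s, x))" for a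
    proof -
      have "continuous_on (S \<times> UNIV) (\<lambda>p. (\<lambda>(s, x). H s x) (fst p, a))"
        by (rule continuous_on_compose2[OF cont]) (auto intro!: continuous_intros)
      from isCont_strip[OF assms(1) this \<open>s \<in> S\<close>] have "isCont (\<lambda>p. H (fst p) a) (s, x)"
        by simp
      then show ?thesis by (simp add: isCont_def)
    qed
    have lims: "(snd \<longlongrightarrow> x) (at (s, x))"
      using tendsto_snd[OF tendsto_ident_at, of "(s, x)"] by simp
    show "\<forall>\<^sub>F p in at (s, x). a < A (fst p) (snd p)" if "a < A s x" for a
    proof -
      have "H s a < x"
        using strict_monoD[OF mono[OF \<open>s \<in> S\<close>] that] inv[OF \<open>s \<in> S\<close>] by simp
      \<comment> \<open>The number y separates the two moving quantities: H at the nearby parameter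
        stays below it and the nearby x stays above it.\<close>
      then obtain y where y: "H s a < y" "y < x" using dense by blast
      show ?thesis
        using ev order_tendstoD(2)[OF lim y(1)] order_tendstoD(1)[OF lims y(2)]
      proof eventually_elim
        case (elim p)
        then have "H (fst p) a < H (fst p) (A (fst p) (snd p))"
          using inv by simp
        then show ?case
          using mono[OF elim(1)] by (simp add: strict_mono_less)
      qed
    qed
    show "\<forall>\<^sub>F p in at (s, x). A (fst p) (snd p) < a" if "A s x < a" for a
    proof -
      have "x < H s a"
        using strict_monoD[OF mono[OF \<open>s \<in> S\<close>] that] inv[OF \<open>s \<in> S\<close>] by simp
      then obtain y where y: "x < y" "y < H s a" using dense by blast
      show ?thesis
        using ev order_tendstoD(1)[OF lim y(2)] order_tendstoD(2)[OF lims y(1)]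
      proof eventually_elim
        case (elim p)
        then have "H (fst p) (A (fst p) (snd p)) < H (fst p) a"
          using inv by simp
        then show ?case
          using mono[OF elim(1)] by (simp add: strict_mono_less)
      qed
    qed
  qed
  then show ?thesis
    unfolding continuous_on_eq_continuous_at[OF op] isCont_def split_def by auto
qed

text \<open>\<open>A\<close> is the second component of the inverse of \<open>(s, a) \<mapsto> (s, H s a)\<close>, so its
  partial derivatives are smooth functions of \<open>(s, A)\<close>, which lifts the order of smoothness by one.\<close>

lemma ck_on_implicit:
  assumes "open S" "ck_on n S H"
    and mono: "\<And>s. s \<in> S \<Longrightarrow> strict_mono (H s)"
    and inv: "\<And>s x. s \<in> S \<Longrightarrow> H s (A s x) = x"
    and H2: "\<And>s x. s \<in> S \<Longrightarrow> (H s has_real_derivative H2 s x) (at x)"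
    and pos: "\<And>s x. s \<in> S \<Longrightarrow> H2 s x > 0"
  shows "ck_on n S A"
  using assms(2)
proof (induction n)
  case 0
  then show ?case using continuous_on_implicit[OF assms(1) _ mono inv] by simp
next
  case (Suc n)
  obtain f1 f2 where f:
    "\<And>s x. s \<in> S \<Longrightarrow> ((\<lambda>s. H s x) has_real_derivative f1 s x) (at s)"
    "\<And>s x. s \<in> S \<Longrightarrow> (H s has_real_derivative f2 s x) (at x)"
    "ck_on n S f1" "ck_on n S f2"
    using Suc.prems by (rule ck_on_SucE) blast
  have f2_pos: "f2 s x > 0" if "s \<in> S" for s x
    using DERIV_unique[OF f(2) H2] pos that by metis
  have op: "open (S \<times> (UNIV :: real set))"
    using assms(1) by (simp add: open_Times)
  have A: "ck_on n S A"
    using Suc.IH ck_on_Suc[OF Suc.prems] .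
  have contA: "continuous_on (S \<times> UNIV) (\<lambda>(s, x). A s x)"
    by (rule continuous_on_implicit[OF assms(1) ck_on_continuous[OF Suc.prems] mono inv])
  \<comment> \<open>Implicit differentiation of H s (A s x) = x: \<open>r\<close> is the
    x-derivative of \<open>A\<close>, and \<open>q\<close> is its s-derivative, minus the quotient
    of the two partial derivatives of \<open>H\<close>.\<close>
  define r where "r s x = 1 / f2 s (A s x)" for s x
  define q where "q s x = - 1 * f1 s (A s x) * r s x" for s x
  have ck_r: "ck_on n S r"
    unfolding r_def by (intro ck_on_inverse ck_on_compose[OF assms(1) f(4) _ A] ck_on_fst f2_pos)
  have ck_q: "ck_on n S q"
    unfolding q_def by (intro ck_on_mult ck_on_const ck_on_compose[OF assms(1) f(3) _ A] ck_on_fst ck_r)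
  have total: "((\<lambda>(s, x). (s, A s x)) has_derivative (\<lambda>(h, k). (h, q s x * h + r s x * k))) (at (s, x))"
    if "s \<in> S" for s x
  proof (rule has_derivative_inverse_basic)
    have "((\<lambda>(s, x). H s x) has_derivative (\<lambda>(h, k). f1 s (A s x) * h + f2 s (A s x) * k)) (at (s, A s x))"
      by (rule has_derivative_partials[OF assms(1) that f(1,2) ck_on_continuous[OF f(4)]])
    from has_derivative_Pair[OF has_derivative_fst[OF has_derivative_ident] this]
    show "((\<lambda>(s, x). (s, H s x)) has_derivative (\<lambda>(h, k). (h, f1 s (A s x) * h + f2 s (A s x) * k)))
        (at ((\<lambda>(s, x). (s, A s x)) (s, x)))"
      by (simp add: split_def)
    show "bounded_linear (\<lambda>(h, k). (h, q s x * h + r s x * k))"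
      unfolding split_def
      by (intro bounded_linear_Pair bounded_linear_add bounded_linear_const_mult
          bounded_linear_fst bounded_linear_snd)
    have "f2 s (A s x) \<noteq> 0"
      using f2_pos[OF that, of "A s x"] by simp
    then show "(\<lambda>(h, k). (h, q s x * h + r s x * k)) \<circ>
        (\<lambda>(h, k). (h, f1 s (A s x) * h + f2 s (A s x) * k)) = id"
      unfolding q_def r_def by (simp add: fun_eq_iff divide_simps)
    have "continuous_on (S \<times> UNIV) (\<lambda>(s, x). (s, A s x))"
      using contA by (auto simp: case_prod_beta intro!: continuous_intros)
    then show "isCont (\<lambda>(s, x). (s, A s x)) (s, x)"
      by (rule isCont_strip[OF assms(1) _ that])
    show "open (S \<times> (UNIV :: real set))" "(s, x) \<in> S \<times> UNIV"
      using op that by auto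
    show "(\<lambda>(s, x). (s, H s x)) ((\<lambda>(s, x). (s, A s x)) z) = z" if "z \<in> S \<times> UNIV" for z
      using that inv by auto
  qed
  show ?case
  proof (rule ck_on_SucI[OF contA _ _ ck_q ck_r])
    fix s x assume "s \<in> S"
    have tot: "((\<lambda>(s, x). A s x) has_derivative (\<lambda>(h, k). q s x * h + r s x * k)) (at (s, x))"
      using has_derivative_snd[OF total[OF \<open>s \<in> S\<close>, of x]] by (simp add: split_def)
    have "((\<lambda>s. (s, x)) has_derivative (\<lambda>h. (h, 0))) (at s)"
      by (intro has_derivative_Pair has_derivative_ident has_derivative_const)
    from has_derivative_compose[OF this tot]
    show "((\<lambda>s. A s x) has_real_derivative q s x) (at s)"
      by (simp add: has_field_derivative_def)
    have "((\<lambda>x. (s, x)) has_derivative (\<lambda>h. (0, h))) (at x)"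
      by (intro has_derivative_Pair has_derivative_ident has_derivative_const)
    from has_derivative_compose[OF this tot]
    show "(A s has_real_derivative r s x) (at x)"
      by (simp add: has_field_derivative_def)
  qed
qed

section \<open>Smooth families of periodic functions in Sobolev spaces\<close>

lemma continuous_on_has_real_derivative:
  assumes "\<And>x. (f has_real_derivative f' x) (at x)"
  shows "continuous_on A f"
  by (intro continuous_at_imp_continuous_on ballI DERIV_isCont[OF assms])

lemma fourier_coeff_eq_integral:
  assumes "L > 0" "continuous_on UNIV u"
  shows "fourier_coeff L u m =
    integral {0..L} (\<lambda>x. complex_of_real (u x) * cis (- (2 * pi * of_int m * x / L))) / of_real L"
proof -
  have "continuous_on {0..L} (\<lambda>x. complex_of_real (u x) * cis (- (2 * pi * of_int m * x / L)))"
    using assms(1) by (intro continuous_intros continuous_on_subset[OF assms(2)]) auto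
  then have "(CLBINT x=ereal 0..ereal L. complex_of_real (u x) * cis (- (2 * pi * of_int m * x / L))) =
      integral {0..L} (\<lambda>x. complex_of_real (u x) * cis (- (2 * pi * of_int m * x / L)))"
    using assms(1) by (intro interval_integral_eq_integral borel_integrable_atLeastAtMost') auto
  then show ?thesis
    unfolding fourier_coeff_def by (simp add: zero_ereal_def)
qed

lemma cmod_fourier_coeff_le:
  assumes "L > 0" "continuous_on UNIV u" "\<And>x. x \<in> {0..L} \<Longrightarrow> \<bar>u x\<bar> \<le> M"
  shows "cmod (fourier_coeff L u m) \<le> M"
proof -
  let ?f = "\<lambda>x. complex_of_real (u x) * cis (- (2 * pi * of_int m * x / L))"
  have "continuous_on {0..L} ?f"
    using assms(1) by (intro continuous_intros continuous_on_subset[OF assms(2)]) auto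
  then have "cmod (integral {0..L} ?f) \<le> M * (L - 0)"
    by (rule integral_bound[rotated]) (use assms in \<open>auto simp: norm_mult\<close>)
  then show ?thesis
    using assms(1) by (simp add: fourier_coeff_eq_integral[OF assms(1,2)] norm_divide field_simps)
qed

text \<open>Integration by parts. The boundary terms cancel because \<open>u\<close> and the
  exponential both take equal values at 0 and \<open>L\<close>.\<close>

lemma fourier_coeff_deriv:
  assumes "L > 0" and deriv: "\<And>x. (u has_real_derivative u' x) (at x)"
    and cont: "continuous_on UNIV u'" and per: "u L = u 0"
  shows "fourier_coeff L u' m = \<i> * (2 * pi * of_int m / L) * fourier_coeff L u m"
proof -
  define w where "w = - (2 * pi * of_int m / L)"
  have arg: "- (2 * pi * of_int m * x / L) = w * x" for x
    by (simp add: w_def)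
  let ?e = "\<lambda>x. cis (w * x)"
  have contu: "continuous_on UNIV u"
    by (rule continuous_on_has_real_derivative[OF deriv])
  have int: "(\<lambda>x. complex_of_real (v x) * ?e x) integrable_on {0..L}" if "continuous_on UNIV v" for v
    by (intro integrable_continuous_real continuous_intros continuous_on_subset[OF that]) auto
  have cisd: "(?e has_vector_derivative \<i> * w * ?e x) (at x within A)" for x A
  proof -
    have "((\<lambda>z. exp (\<i> * (of_real w * z))) has_field_derivative
        \<i> * w * exp (\<i> * (of_real w * of_real x))) (at (of_real x))"
      by (auto intro!: derivative_eq_intros)
    from has_vector_derivative_real_field[OF this] show ?thesis
      by (simp add: cis_conv_exp)
  qed
  have ud: "((\<lambda>x. complex_of_real (u x)) has_vector_derivative of_real (u' x)) (at x within A)" for x A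
    using deriv[of x] by (intro has_vector_derivative_of_real has_vector_derivative_at_within)
      (auto simp: has_real_derivative_iff_has_vector_derivative)
  have "((\<lambda>x. complex_of_real (u x) * (\<i> * w * ?e x) + of_real (u' x) * ?e x) has_integral
      (complex_of_real (u L) * ?e L - complex_of_real (u 0) * ?e 0)) {0..L}"
    using assms(1) by (intro fundamental_theorem_of_calculus has_vector_derivative_mult ud cisd) auto
  moreover have "?e L = 1"
    using assms(1) cis_multiple_2pi[of "- of_int m"] by (simp add: w_def)
  ultimately have "((\<lambda>x. complex_of_real (u x) * (\<i> * w * ?e x) + of_real (u' x) * ?e x) has_integral 0) {0..L}"
    using per by simp
  then have "0 = integral {0..L} (\<lambda>x. \<i> * w * (complex_of_real (u x) * ?e x) + of_real (u' x) * ?e x)"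
    by (simp add: algebra_simps integral_unique)
  also have "\<dots> = \<i> * w * integral {0..L} (\<lambda>x. complex_of_real (u x) * ?e x) +
      integral {0..L} (\<lambda>x. of_real (u' x) * ?e x)"
    by (subst integral_add) (auto intro!: int cont contu integrable_on_mult_right)
  finally have "integral {0..L} (\<lambda>x. of_real (u' x) * ?e x) =
      - (\<i> * w * integral {0..L} (\<lambda>x. complex_of_real (u x) * ?e x))"
    by (simp add: eq_neg_iff_add_eq_0 add.commute)
  then show ?thesis
    unfolding fourier_coeff_eq_integral[OF assms(1) cont] fourier_coeff_eq_integral[OF assms(1) contu] arg
    by (simp add: w_def)
qed

text \<open>Each differentiation multiplies the m-th coefficient by a factor of modulus 2 pi |m| /
  L, and the coefficient of the last derivative is at most its sup norm. Derivatives inherit the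
  period, so the induction can shift the sequence \<open>v\<close> by one.\<close>

lemma cmod_fourier_coeff_power_le:
  fixes v :: "nat \<Rightarrow> real \<Rightarrow> real"
  assumes "L > 0"
    and deriv: "\<And>i x. i < p \<Longrightarrow> (v i has_real_derivative v (Suc i) x) (at x)"
    and cont: "continuous_on UNIV (v p)" and per: "\<And>x. v 0 (x + L) = v 0 x"
    and bound: "\<And>x. x \<in> {0..L} \<Longrightarrow> \<bar>v p x\<bar> \<le> M"
  shows "(2 * pi * \<bar>of_int m\<bar> / L) ^ p * cmod (fourier_coeff L (v 0) m) \<le> M"
  using deriv cont per bound
proof (induction p arbitrary: v)
  case 0
  then show ?case using cmod_fourier_coeff_le[OF assms(1)] by simp
next
  case (Suc p)
  have cont: "continuous_on UNIV (v (Suc 0))"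
  proof (cases p)
    case 0
    then show ?thesis using Suc.prems(2) by simp
  next
    case (Suc q)
    then show ?thesis
      by (intro continuous_on_has_real_derivative[OF Suc.prems(1)]) simp
  qed
  have per1: "v (Suc 0) (x + L) = v (Suc 0) x" for x
  proof -
    have "((\<lambda>x. v 0 (x + L)) has_real_derivative v (Suc 0) (x + L)) (at x)"
      using Suc.prems(1)[of 0 "x + L"] by (simp add: DERIV_shift)
    then have "(v 0 has_real_derivative v (Suc 0) (x + L)) (at x)"
      by (simp add: Suc.prems(3))
    then show ?thesis
      by (rule DERIV_unique) (use Suc.prems(1)[of 0 x] in simp)
  qed
  have "(2 * pi * \<bar>of_int m\<bar> / L) ^ p * cmod (fourier_coeff L (v (Suc 0)) m) \<le> M"
    by (rule Suc.IH[of "\<lambda>i. v (Suc i)"]) (use Suc.prems cont per1 in auto)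
  moreover have "cmod (fourier_coeff L (v (Suc 0)) m) =
      (2 * pi * \<bar>of_int m\<bar> / L) * cmod (fourier_coeff L (v 0) m)"
    using assms(1) Suc.prems(1)[of 0] Suc.prems(3)[of 0]
    by (subst fourier_coeff_deriv[OF assms(1) _ cont, of "v 0"]) (auto simp: norm_mult norm_divide)
  ultimately show ?case
    by (simp add: mult_ac)
qed

text \<open>For nonzero m, 1 + m^2 is at most 2 m^2, which is L^2 / (2 pi^2) times (2 pi |m| / L)^2;
  the power is what n + 1 such factors cost. The summand 1 takes care of m = 0.\<close>

definition sobolev_const :: "nat \<Rightarrow> real \<Rightarrow> real" where
  "sobolev_const n L = 1 + (L\<^sup>2 / (2 * pi\<^sup>2)) ^ Suc n"

text \<open>One derivative beyond order \<open>n\<close> is spent on a spare factor 1 / (1 + m^2),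
  which makes the bound summable over m.\<close>

lemma Hper_term_le:
  fixes v :: "nat \<Rightarrow> real \<Rightarrow> real"
  assumes "L > 0"
    and deriv: "\<And>i x. i \<le> n \<Longrightarrow> (v i has_real_derivative v (Suc i) x) (at x)"
    and cont: "continuous_on UNIV (v (Suc n))" and per: "\<And>x. v 0 (x + L) = v 0 x"
    and bound: "\<And>x. x \<in> {0..L} \<Longrightarrow> \<bar>v 0 x\<bar> \<le> M" "\<And>x. x \<in> {0..L} \<Longrightarrow> \<bar>v (Suc n) x\<bar> \<le> M"
  shows "Hper_term n L (v 0) m \<le> sobolev_const n L * M\<^sup>2 * (1 / (1 + (of_int m)\<^sup>2))"
proof -
  define a where "a = cmod (fourier_coeff L (v 0) m)"
  have "a \<ge> 0" by (simp add: a_def)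
  have pos: "1 + (real_of_int m)\<^sup>2 > 0"
    by (simp add: add_pos_nonneg)
  have "(1 + (real_of_int m)\<^sup>2) ^ Suc n * a\<^sup>2 \<le> sobolev_const n L * M\<^sup>2"
  proof (cases "m = 0")
    case True
    have "continuous_on UNIV (v 0)"
      by (rule continuous_on_has_real_derivative[OF deriv[OF le0]])
    then have "a\<^sup>2 \<le> M\<^sup>2"
      using cmod_fourier_coeff_le[OF assms(1) _ bound(1)] \<open>a \<ge> 0\<close>
      by (intro power_mono) (auto simp: a_def)
    also have "\<dots> \<le> sobolev_const n L * M\<^sup>2"
      unfolding sobolev_const_def using mult_right_mono[of 1 _ "M\<^sup>2"] by simp
    finally show ?thesis using True by simp
  next
    case False
    have M: "(2 * pi * \<bar>of_int m\<bar> / L) ^ Suc n * a \<le> M"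
      unfolding a_def using cont per bound(2)
      by (intro cmod_fourier_coeff_power_le[where v = v] assms(1) deriv) auto
    have "1 \<le> \<bar>m\<bar>" using False by simp
    then have "1\<^sup>2 \<le> (real_of_int \<bar>m\<bar>)\<^sup>2" by (intro power_mono) linarith+
    then have "(1 + (real_of_int m)\<^sup>2) ^ Suc n \<le> (2 * (real_of_int m)\<^sup>2) ^ Suc n"
      by (intro power_mono) auto
    also have "2 * (real_of_int m)\<^sup>2 = L\<^sup>2 / (2 * pi\<^sup>2) * (2 * pi * \<bar>of_int m\<bar> / L)\<^sup>2"
      using assms(1) by (simp add: power_divide power_mult_distrib field_simps)
    finally have "(1 + (real_of_int m)\<^sup>2) ^ Suc n * a\<^sup>2 \<le>
        (L\<^sup>2 / (2 * pi\<^sup>2) * (2 * pi * \<bar>of_int m\<bar> / L)\<^sup>2) ^ Suc n * a\<^sup>2"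
      by (intro mult_right_mono) auto
    also have "\<dots> = (L\<^sup>2 / (2 * pi\<^sup>2)) ^ Suc n * ((2 * pi * \<bar>of_int m\<bar> / L) ^ Suc n * a)\<^sup>2"
      by (simp only: power_mult_distrib power_mult[symmetric] mult.commute[of 2] mult.assoc)
    also have "\<dots> \<le> (L\<^sup>2 / (2 * pi\<^sup>2)) ^ Suc n * M\<^sup>2"
      using M assms(1) \<open>a \<ge> 0\<close> by (intro mult_left_mono power_mono) auto
    also have "\<dots> \<le> sobolev_const n L * M\<^sup>2"
      unfolding sobolev_const_def by (intro mult_right_mono) auto
    finally show ?thesis .
  qed
  then have "(1 + (real_of_int m)\<^sup>2) ^ n * a\<^sup>2 * (1 + (real_of_int m)\<^sup>2) \<le> sobolev_const n L * M\<^sup>2"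
    by (simp add: mult_ac)
  then show ?thesis
    using pos by (simp add: Hper_term_def a_def field_simps)
qed

lemma summable_on_int_inverse_square: "(\<lambda>m::int. 1 / (1 + (real_of_int m)\<^sup>2)) summable_on UNIV"
proof -
  let ?f = "\<lambda>m::int. 1 / (1 + (real_of_int m)\<^sup>2)"
  have "summable (\<lambda>n. 2 * (1 / (real n + 1)\<^sup>2))"
    using sums_summable[OF inverse_squares_sums] by (intro summable_mult) (simp add: add.commute)
  then have "summable (\<lambda>n. 1 / (1 + (real n)\<^sup>2))"
  proof (rule summable_comparison_test[rotated], intro exI[of _ 0] allI impI)
    fix n
    \<comment> \<open>This is (n - 1)^2 \<ge> 0 rearranged; it compares the series with that of the
      inverse squares.\<close>
    have "(real n + 1)\<^sup>2 \<le> 2 * (1 + (real n)\<^sup>2)"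
      using zero_le_power2[of "real n - 1"] by (simp add: power2_eq_square algebra_simps)
    moreover have "1 / a \<le> 2 * (1 / b)" if "b \<le> 2 * a" "a > 0" "b > 0" for a b :: real
      using that by (simp add: field_simps)
    ultimately show "norm (1 / (1 + (real n)\<^sup>2)) \<le> 2 * (1 / (real n + 1)\<^sup>2)"
      by (simp add: add_pos_nonneg)
  qed
  then have nat: "(\<lambda>n. 1 / (1 + (real n)\<^sup>2)) summable_on UNIV"
    by (rule summable_nonneg_imp_summable_on) simp
  have "?f summable_on range int" "?f summable_on range (\<lambda>n. - int n)"
    using nat by (subst summable_on_reindex; simp add: inj_on_def o_def)+
  then have "?f summable_on (range int \<union> range (\<lambda>n. - int n))"
    by (rule summable_on_union)
  moreover have "range int \<union> range (\<lambda>n. - int n) = UNIV"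
  proof (intro equalityI subset_UNIV subsetI)
    show "m \<in> range int \<union> range (\<lambda>n. - int n)" for m
      by (cases m rule: int_cases2) auto
  qed
  ultimately show ?thesis by simp
qed

lemma Hper_term_nonneg: "Hper_term n L u m \<ge> 0"
  by (simp add: Hper_term_def)

text \<open>The factor in front of \<open>M\<close> depends on \<open>n\<close> and \<open>L\<close>
  only, so uniform smallness of a function and of its derivative of order n + 1 becomes smallness in
  the Sobolev norm.\<close>

lemma
  fixes v :: "nat \<Rightarrow> real \<Rightarrow> real"
  assumes "L > 0"
    and deriv: "\<And>i x. i \<le> n \<Longrightarrow> (v i has_real_derivative v (Suc i) x) (at x)"
    and cont: "continuous_on UNIV (v (Suc n))" and per: "\<And>x. v 0 (x + L) = v 0 x"
    and bound: "\<And>x. x \<in> {0..L} \<Longrightarrow> \<bar>v 0 x\<bar> \<le> M" "\<And>x. x \<in> {0..L} \<Longrightarrow> \<bar>v (Suc n) x\<bar> \<le> M"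
  shows Hper_term_summable: "Hper_term n L (v 0) summable_on UNIV"
    and Hper_norm_le: "Hper_norm n L (v 0) \<le>
      sqrt (L * sobolev_const n L * infsum (\<lambda>m::int. 1 / (1 + (real_of_int m)\<^sup>2)) UNIV) * M"
proof -
  let ?f = "\<lambda>m::int. 1 / (1 + (real_of_int m)\<^sup>2)"
  have M: "M \<ge> 0"
    using bound(1)[of 0] assms(1) by auto
  have le: "Hper_term n L (v 0) m \<le> sobolev_const n L * M\<^sup>2 * ?f m" for m
    by (rule Hper_term_le[where v = v, OF assms])
  have sum: "(\<lambda>m. sobolev_const n L * M\<^sup>2 * ?f m) summable_on UNIV"
    by (rule summable_on_cmult_right[OF summable_on_int_inverse_square])
  show smb: "Hper_term n L (v 0) summable_on UNIV"
    by (rule summable_on_comparison_test[OF sum le Hper_term_nonneg])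
  have "infsum (Hper_term n L (v 0)) UNIV \<le> infsum (\<lambda>m. sobolev_const n L * M\<^sup>2 * ?f m) UNIV"
    by (rule infsum_mono[OF smb sum le])
  also have "\<dots> = sobolev_const n L * M\<^sup>2 * infsum ?f UNIV"
    by (rule infsum_cmult_right[OF summable_on_int_inverse_square])
  finally have "L * infsum (Hper_term n L (v 0)) UNIV \<le>
      (L * sobolev_const n L * infsum ?f UNIV) * M\<^sup>2"
    using assms(1) by (simp add: mult_ac)
  then have "Hper_norm n L (v 0) \<le> sqrt ((L * sobolev_const n L * infsum ?f UNIV) * M\<^sup>2)"
    unfolding Hper_norm_def by (rule real_sqrt_le_mono)
  then show "Hper_norm n L (v 0) \<le> sqrt (L * sobolev_const n L * infsum ?f UNIV) * M"
    using M by (simp add: real_sqrt_mult)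
qed

lemma Hper_norm_nonneg: "L > 0 \<Longrightarrow> Hper_norm n L u \<ge> 0"
  unfolding Hper_norm_def by (simp add: infsum_nonneg Hper_term_nonneg)

lemma HperI:
  fixes v :: "nat \<Rightarrow> real \<Rightarrow> real"
  assumes "L > 0"
    and deriv: "\<And>i x. (v i has_real_derivative v (Suc i) x) (at x)"
    and per: "\<And>x. v 0 (x + L) = v 0 x"
  shows "v 0 \<in> Hper n L"
proof -
  have cont: "continuous_on UNIV (v i)" for i
    by (rule continuous_on_has_real_derivative[OF deriv])
  have bdd: "\<exists>M. \<forall>x\<in>{0..L}. \<bar>v i x\<bar> \<le> M" for i
  proof -
    have "continuous_on {0..L} (v i)"
      by (rule continuous_on_subset[OF cont]) simp
    from compact_imp_bounded[OF compact_continuous_image[OF this compact_Icc]]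
    show ?thesis by (auto simp: bounded_iff)
  qed
  obtain M0 M1 where M: "\<And>x. x \<in> {0..L} \<Longrightarrow> \<bar>v 0 x\<bar> \<le> M0"
      "\<And>x. x \<in> {0..L} \<Longrightarrow> \<bar>v (Suc n) x\<bar> \<le> M1"
    using bdd by metis
  have "Hper_term n L (v 0) summable_on UNIV"
  proof (rule Hper_term_summable[where v = v, OF assms(1) deriv cont per])
    show "\<bar>v 0 x\<bar> \<le> max M0 M1" "\<bar>v (Suc n) x\<bar> \<le> max M0 M1" if "x \<in> {0..L}" for x
      using M[OF that] by auto
  qed
  moreover have "set_integrable lborel {0..L} (\<lambda>x. (v 0 x)\<^sup>2)"
    by (intro borel_integrable_atLeastAtMost' continuous_intros continuous_on_subset[OF cont]) auto
  ultimately show ?thesis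
    unfolding Hper_def using borel_measurable_continuous_onI[OF cont] per
    by (auto simp: periodic_fun_simple_def)
qed

section \<open>From joint smoothness to smooth curves in Sobolev spaces\<close>

definition smooth_on :: "real set \<Rightarrow> (real \<Rightarrow> real \<Rightarrow> real) \<Rightarrow> bool" where
  "smooth_on S f \<longleftrightarrow> (\<forall>n. ck_on n S f)"

text \<open>Every order of \<open>ck_on\<close> has its own witnesses. Choosing the derivative by
  \<open>deriv\<close> gives one function for all orders, which can then be iterated.\<close>

definition deriv1 :: "(real \<Rightarrow> real \<Rightarrow> real) \<Rightarrow> real \<Rightarrow> real \<Rightarrow> real" where
  "deriv1 f s x = deriv (\<lambda>s. f s x) s"

definition deriv2 :: "(real \<Rightarrow> real \<Rightarrow> real) \<Rightarrow> real \<Rightarrow> real \<Rightarrow> real" where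
  "deriv2 f s x = deriv (f s) x"

lemma smooth_on_continuous: "smooth_on S f \<Longrightarrow> continuous_on (S \<times> UNIV) (\<lambda>(s, x). f s x)"
  using ck_on_continuous unfolding smooth_on_def by blast

text \<open>Uniqueness of derivatives identifies the witnesses of each order with
  \<open>deriv1 f\<close> and \<open>deriv2 f\<close> on \<open>S\<close>.\<close>

lemma
  assumes "open S" "smooth_on S f"
  shows smooth_on_deriv1: "smooth_on S (deriv1 f)"
    and smooth_on_deriv2: "smooth_on S (deriv2 f)"
    and has_deriv1: "s \<in> S \<Longrightarrow> ((\<lambda>s. f s x) has_real_derivative deriv1 f s x) (at s)"
    and has_deriv2: "s \<in> S \<Longrightarrow> (f s has_real_derivative deriv2 f s x) (at x)"
proof -
  have *: "ck_on n S (deriv1 f) \<and> ck_on n S (deriv2 f) \<and>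
     (\<forall>s\<in>S. \<forall>x. ((\<lambda>s. f s x) has_real_derivative deriv1 f s x) (at s) \<and>
      (f s has_real_derivative deriv2 f s x) (at x))" for n
  proof -
    have "ck_on (Suc n) S f"
      using assms(2) unfolding smooth_on_def by blast
    then obtain f1 f2 where f:
      "\<And>s x. s \<in> S \<Longrightarrow> ((\<lambda>s. f s x) has_real_derivative f1 s x) (at s)"
      "\<And>s x. s \<in> S \<Longrightarrow> (f s has_real_derivative f2 s x) (at x)"
      "ck_on n S f1" "ck_on n S f2"
      by (rule ck_on_SucE) blast
    have eq: "f1 s x = deriv1 f s x" "f2 s x = deriv2 f s x" if "s \<in> S" for s x
      using DERIV_imp_deriv[OF f(1)[OF that]] DERIV_imp_deriv[OF f(2)[OF that]]
      by (auto simp: deriv1_def deriv2_def)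
    show ?thesis
      using ck_on_cong[OF assms(1) eq(1) f(3)] ck_on_cong[OF assms(1) eq(2) f(4)] f(1,2) eq by metis
  qed
  show "smooth_on S (deriv1 f)" "smooth_on S (deriv2 f)"
    and "s \<in> S \<Longrightarrow> ((\<lambda>s. f s x) has_real_derivative deriv1 f s x) (at s)"
    and "s \<in> S \<Longrightarrow> (f s has_real_derivative deriv2 f s x) (at x)"
    using * unfolding smooth_on_def by blast+
qed

text \<open>Uniform continuity of \<open>deriv1 h\<close> on a compact product supplies one radius
  for all x in [0, L]; the mean value inequality turns it into a bound for the quotient.\<close>

lemma difference_quotient_uniform_limit:
  assumes "open S" "smooth_on S h" "c \<in> S" "\<epsilon> > 0"
  shows "\<forall>\<^sub>F y in at c. \<forall>x\<in>{0..L}. \<bar>(h y x - h c x) / (y - c) - deriv1 h c x\<bar> \<le> \<epsilon>"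
proof -
  obtain r where r: "r > 0" "cball c r \<subseteq> S"
    using assms(1,3) open_contains_cball by blast
  have "continuous_on (cball c r \<times> {0..L}) (\<lambda>(s, x). deriv1 h s x)"
    using smooth_on_continuous[OF smooth_on_deriv1[OF assms(1,2)]]
    by (rule continuous_on_subset) (use r in auto)
  then have "uniformly_continuous_on (cball c r \<times> {0..L}) (\<lambda>(s, x). deriv1 h s x)"
    by (rule compact_uniformly_continuous) (intro compact_Times compact_cball compact_Icc)
  then obtain d where d: "d > 0" "\<And>p q. p \<in> cball c r \<times> {0..L} \<Longrightarrow> q \<in> cball c r \<times> {0..L} \<Longrightarrow>
      dist q p < d \<Longrightarrow> dist ((\<lambda>(s, x). deriv1 h s x) q) ((\<lambda>(s, x). deriv1 h s x) p) < \<epsilon>"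
    unfolding uniformly_continuous_on_def using assms(4) by metis
  define \<delta> where "\<delta> = min r d"
  have "\<delta> > 0" using r d by (simp add: \<delta>_def)
  have "\<bar>(h y x - h c x) / (y - c) - deriv1 h c x\<bar> \<le> \<epsilon>"
    if "y \<noteq> c" "dist y c < \<delta>" "x \<in> {0..L}" for y x
  proof -
    \<comment> \<open>Subtracting the linear function s * \<open>deriv1 h c x\<close> leaves a
      function of s whose derivative is at most \<epsilon> in absolute value near c.\<close>
    have "norm ((h y x - y * deriv1 h c x) - (h c x - c * deriv1 h c x)) \<le> \<epsilon> * norm (y - c)"
    proof (rule field_differentiable_bound[where S = "ball c \<delta>" and f' = "\<lambda>s. deriv1 h s x - deriv1 h c x"])
      fix s assume s: "s \<in> ball c \<delta>"
      then have "s \<in> cball c r" "s \<in> S"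
        using r by (auto simp: \<delta>_def)
      show "((\<lambda>s. h s x - s * deriv1 h c x) has_real_derivative deriv1 h s x - deriv1 h c x)
          (at s within ball c \<delta>)"
        by (rule has_field_derivative_at_within)
           (auto intro!: derivative_eq_intros has_deriv1[OF assms(1,2) \<open>s \<in> S\<close>])
      show "norm (deriv1 h s x - deriv1 h c x) \<le> \<epsilon>"
        using d(2)[of "(c, x)" "(s, x)"] \<open>s \<in> cball c r\<close> s that(3) r(1)
        by (auto simp: dist_Pair_Pair dist_real_def \<delta>_def abs_minus_commute)
    qed (use that \<open>\<delta> > 0\<close> in \<open>auto simp: dist_commute\<close>)
    moreover have "(h y x - h c x) / (y - c) - deriv1 h c x =
        ((h y x - y * deriv1 h c x) - (h c x - c * deriv1 h c x)) / (y - c)"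
      using that(1) by (simp add: field_simps)
    ultimately show ?thesis
      using that(1) by (simp add: divide_simps)
  qed
  then show ?thesis
    unfolding eventually_at using \<open>\<delta> > 0\<close> by blast
qed

text \<open>The error of the difference quotient is differentiated in x. Since mixed partial
  derivatives commute, each x-derivative of the error is again such an error, now for an
  x-derivative of \<open>f\<close>, and tends to 0 uniformly on a period. Orders 0 and n + 1 control
  the norm.\<close>

lemma Hper_has_deriv_deriv1:
  assumes "L > 0" "open S" "smooth_on S f" "c \<in> S"
    and per: "\<And>s x. s \<in> S \<Longrightarrow> f s (x + L) = f s x"
    and per1: "\<And>x. deriv1 f c (x + L) = deriv1 f c x"
  shows "Hper_has_deriv n L f (deriv1 f c) c S"
proof -
  define h where "h i = (deriv2 ^^ i) f" for i
  have h_Suc: "h (Suc i) = deriv2 (h i)" for i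
    by (simp add: h_def)
  have smooth: "smooth_on S (h i)" for i
    by (induction i) (auto simp: h_def assms(3) intro: smooth_on_deriv2[OF assms(2)])
  define v where "v y i x = (h i y x - h i c x) / (y - c) - deriv1 (h i) c x" for y i x
  have D: "(deriv1 (h i) c has_real_derivative deriv1 (h (Suc i)) c x) (at x)" for i x
    using mixed_partials_eq[OF assms(2) has_deriv1[OF assms(2) smooth]
      has_deriv2[OF assms(2) smooth, folded h_Suc] has_deriv1[OF assms(2) smooth]
      smooth_on_continuous[OF smooth] smooth_on_continuous[OF smooth_on_deriv1[OF assms(2) smooth]] assms(4)] .
  have deriv: "(v y i has_real_derivative v y (Suc i) x) (at x)" if "y \<in> S" for y i x
    unfolding v_def
    by (intro DERIV_diff DERIV_cdivide D has_deriv2[OF assms(2) smooth, folded h_Suc] that assms(4))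
  define K where "K = sqrt (L * sobolev_const n L * infsum (\<lambda>m::int. 1 / (1 + (real_of_int m)\<^sup>2)) UNIV)"
  have "((\<lambda>y. Hper_norm n L (v y 0)) \<longlongrightarrow> 0) (at c)"
  proof (rule tendstoI)
    fix e :: real assume "e > 0"
    \<comment> \<open>The absolute value and the summand 1 make the denominator positive and larger
      than K.\<close>
    define \<epsilon> where "\<epsilon> = e / (\<bar>K\<bar> + 1)"
    have "\<epsilon> > 0" using \<open>e > 0\<close> by (simp add: \<epsilon>_def add_nonneg_pos)
    have "\<forall>\<^sub>F y in at c. y \<in> S"
      using eventually_at_in_open'[OF assms(2,4)] .
    then show "\<forall>\<^sub>F y in at c. dist (Hper_norm n L (v y 0)) 0 < e"
      using difference_quotient_uniform_limit[OF assms(2) smooth assms(4) \<open>\<epsilon> > 0\<close>, of L 0]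
        difference_quotient_uniform_limit[OF assms(2) smooth assms(4) \<open>\<epsilon> > 0\<close>, of L "Suc n"]
    proof eventually_elim
      case (elim y)
      have cont: "continuous_on UNIV (v y (Suc n))"
        by (rule continuous_on_has_real_derivative[OF deriv[OF elim(1)]])
      have "Hper_norm n L (v y 0) \<le> K * \<epsilon>"
        unfolding K_def
        by (rule Hper_norm_le[where v = "v y", OF assms(1) deriv[OF elim(1)] cont])
           (use elim per per1 assms(4) in \<open>auto simp: v_def h_def\<close>)
      also have "\<dots> \<le> \<bar>K\<bar> * \<epsilon>"
        using \<open>\<epsilon> > 0\<close> by (intro mult_right_mono) auto
      also have "\<dots> < (\<bar>K\<bar> + 1) * \<epsilon>"
        using \<open>\<epsilon> > 0\<close> by (intro mult_strict_right_mono) auto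
      also have "\<dots> = e"
        by (simp add: \<epsilon>_def)
      finally show ?case
        using Hper_norm_nonneg[OF assms(1)] by simp
    qed
  qed
  then show ?thesis
    unfolding Hper_has_deriv_def v_def h_def
    by (simp add: at_within_open[OF assms(4,2)])
qed

text \<open>The iterated parameter derivatives serve as the curves \<open>G j\<close>. They stay
  periodic because f s (x + L) = f s x, valid on an open set of s, may be differentiated in
  s.\<close>

theorem smooth_into_HperI:
  assumes "L > 0" "open S" "smooth_on S f" and per: "\<And>s x. s \<in> S \<Longrightarrow> f s (x + L) = f s x"
  shows "smooth_into_Hper n L S f"
proof -
  define G where "G j = (deriv1 ^^ j) f" for j
  have per1: "deriv1 g s (x + L) = deriv1 g s x"
    if "smooth_on S g" "\<And>s x. s \<in> S \<Longrightarrow> g s (x + L) = g s x" "s \<in> S" for g s x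
  proof -
    have "((\<lambda>s. g s x) has_real_derivative deriv1 g s (x + L)) (at s)"
      using has_deriv1[OF assms(2) that(1,3), of "x + L"] assms(2) that(3) that(2)
      by (rule has_field_derivative_transform_within_open)
    then show ?thesis
      by (rule DERIV_unique[OF _ has_deriv1[OF assms(2) that(1,3)]])
  qed
  have G: "smooth_on S (G j) \<and> (\<forall>s\<in>S. \<forall>x. G j s (x + L) = G j s x)" for j
    by (induction j) (auto simp: G_def assms(3) per per1 intro: smooth_on_deriv1[OF assms(2)])
  have "G j c \<in> Hper n L" if "c \<in> S" for j c
  proof -
    define v where "v i = ((deriv2 ^^ i) (G j)) c" for i
    have sm: "smooth_on S ((deriv2 ^^ i) (G j))" for i
      using G by (induction i) (auto intro: smooth_on_deriv2[OF assms(2)])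
    have "v 0 \<in> Hper n L"
    proof (rule HperI[where v = v, OF assms(1)])
      show "(v i has_real_derivative v (Suc i) x) (at x)" for i x
        using has_deriv2[OF assms(2) sm that] by (simp add: v_def)
      show "v 0 (x + L) = v 0 x" for x
        using G that by (simp add: v_def)
    qed
    then show ?thesis by (simp add: v_def)
  qed
  moreover have "Hper_has_deriv n L (G j) (G (Suc j) c) c S" if "c \<in> S" for j c
  proof -
    have "Hper_has_deriv n L (G j) (deriv1 (G j) c) c S"
      using G[of j] that by (intro Hper_has_deriv_deriv1 per1 assms(1,2)) auto
    then show ?thesis by (simp add: G_def)
  qed
  ultimately show ?thesis
    unfolding smooth_into_Hper_def by (intro exI[of _ G]) (simp add: G_def)
qed

section \<open>Elliptic integrals and the dnoidal function\<close>

lemma elliptic_radicand_pos: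
  fixes k :: real
  assumes "\<bar>k\<bar> < 1"
  shows "1 - k\<^sup>2 * (sin x)\<^sup>2 > 0"
proof -
  have "k\<^sup>2 < 1"
    using assms by (simp add: abs_square_less_1)
  moreover have "k\<^sup>2 * (sin x)\<^sup>2 \<le> k\<^sup>2"
    using mult_left_mono[of "(sin x)\<^sup>2" 1 "k\<^sup>2"] by (simp add: abs_square_le_1)
  ultimately show ?thesis by simp
qed

text \<open>Differentiation in k turns the exponent -1/2 into -3/2, so the elliptic integrands are
  carried as real powers.\<close>

lemma inverse_sqrt_powr: "x > 0 \<Longrightarrow> 1 / sqrt x = x powr (- 1 / 2)"
  by (simp add: powr_minus powr_half_sqrt field_simps)

lemma ck_on_elliptic_radicand: "ck_on n S (\<lambda>k x. 1 - k\<^sup>2 * (sin x)\<^sup>2)"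
proof -
  have "ck_on n S (\<lambda>k x. 1 + (- 1) * ((k * k) * (sin x * sin x)))"
    by (intro ck_on_add ck_on_mult ck_on_const ck_on_fst ck_on_snd ck_on_sin)
  then show ?thesis by (simp add: power2_eq_square)
qed

lemma ck_on_elliptic_powr: "ck_on n {-1<..<1} (\<lambda>k x. (1 - k\<^sup>2 * (sin x)\<^sup>2) powr a)"
  by (intro ck_on_powr ck_on_elliptic_radicand elliptic_radicand_pos) auto

lemma continuous_on_elliptic_powr:
  fixes k a :: real
  shows "\<bar>k\<bar> < 1 \<Longrightarrow> continuous_on A (\<lambda>x. (1 - k\<^sup>2 * (sin x)\<^sup>2) powr a)"
  using continuous_on_section[OF ck_on_continuous[OF ck_on_elliptic_powr[of 0 a]], of k A]
  by (auto simp: abs_less_iff)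

lemma ellip_F_eq_powr:
  "\<bar>k\<bar> < 1 \<Longrightarrow> ellip_F k x = (LBINT t=0..x. (1 - k\<^sup>2 * (sin t)\<^sup>2) powr (- 1 / 2))"
  unfolding ellip_F_def by (simp only: inverse_sqrt_powr[OF elliptic_radicand_pos])

lemma ck_on_ellip_F: "ck_on n {-1<..<1} ellip_F"
proof -
  have "ck_on n {-1<..<1} (\<lambda>k x. LBINT t=0..x. (1 - k\<^sup>2 * (sin t)\<^sup>2) powr (- 1 / 2))"
    by (intro ck_on_interval_integral ck_on_elliptic_powr) auto
  then show ?thesis
    by (rule ck_on_cong[rotated 2]) (auto simp: ellip_F_eq_powr)
qed

context
  fixes k :: real
  assumes k: "\<bar>k\<bar> < 1"
begin

lemma ellip_F_0 [simp]: "ellip_F k 0 = 0"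
  unfolding ellip_F_def by (simp add: zero_ereal_def)

lemma ellip_F_has_derivative:
  "(ellip_F k has_real_derivative 1 / sqrt (1 - k\<^sup>2 * (sin x)\<^sup>2)) (at x)"
proof -
  have "ellip_F k = (\<lambda>x. LBINT t=0..x. (1 - k\<^sup>2 * (sin t)\<^sup>2) powr (- 1 / 2))"
    using ellip_F_eq_powr[OF k] by blast
  then show ?thesis
    using interval_integral_has_derivative[OF continuous_on_elliptic_powr[OF k], of "- 1 / 2" x]
      inverse_sqrt_powr[OF elliptic_radicand_pos[OF k, of x]] by (simp only:)
qed

lemma elliptic_integrand_ge_1: "1 / sqrt (1 - k\<^sup>2 * (sin x)\<^sup>2) \<ge> 1"
  using elliptic_radicand_pos[OF k, of x] by (simp add: field_simps)

lemma ellip_F_strict_mono: "strict_mono (ellip_F k)"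
proof (rule strict_monoI)
  have "\<exists>D. (ellip_F k has_real_derivative D) (at t) \<and> D > 0" for t
    by (rule exI, rule conjI[OF ellip_F_has_derivative less_le_trans[OF zero_less_one elliptic_integrand_ge_1]])
  then show "ellip_F k x < ellip_F k y" if "x < y" for x y
    using DERIV_pos_imp_increasing[OF that, of "ellip_F k"] by blast
qed

text \<open>The integrand is at least 1. The resulting linear growth makes \<open>ellip_F k\<close>
  unbounded in both directions, hence onto.\<close>

lemma ellip_F_diff_ge:
  assumes "x \<le> y"
  shows "y - x \<le> ellip_F k y - ellip_F k x"
proof -
  have "\<exists>D. ((\<lambda>x. ellip_F k x - x) has_real_derivative D) (at t) \<and> D \<ge> 0" for t
    by (rule exI, rule conjI[OF DERIV_diff[OF ellip_F_has_derivative DERIV_ident]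
          diff_ge_0_iff_ge[THEN iffD2, OF elliptic_integrand_ge_1]])
  then have "ellip_F k x - x \<le> ellip_F k y - y"
    using DERIV_nonneg_imp_nondecreasing[OF assms, of "\<lambda>x. ellip_F k x - x"] by blast
  then show ?thesis by simp
qed

lemma ellip_F_continuous: "isCont (ellip_F k) x"
  using ellip_F_has_derivative by (rule DERIV_isCont)

lemma ellip_F_surj: "\<exists>x. ellip_F k x = u"
proof -
  have "ellip_F k (- \<bar>u\<bar>) \<le> u" "u \<le> ellip_F k \<bar>u\<bar>"
    using ellip_F_diff_ge[of "- \<bar>u\<bar>" 0] ellip_F_diff_ge[of 0 "\<bar>u\<bar>"] by auto
  then show ?thesis
    using IVT[of "ellip_F k" "- \<bar>u\<bar>" u "\<bar>u\<bar>"] ellip_F_continuous by auto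
qed

lemma ellip_F_jacobi_am: "ellip_F k (jacobi_am k u) = u"
proof -
  have "\<exists>!x. ellip_F k x = u"
    using ellip_F_surj strict_mono_eq[OF ellip_F_strict_mono] by metis
  then show ?thesis
    unfolding jacobi_am_def by (rule theI')
qed

lemma jacobi_am_ellip_F: "jacobi_am k (ellip_F k x) = x"
  using ellip_F_jacobi_am strict_mono_eq[OF ellip_F_strict_mono] by blast

lemma ellip_F_minus: "ellip_F k (- x) = - ellip_F k x"
proof -
  have "((\<lambda>x. ellip_F k (- x) + ellip_F k x) has_real_derivative 0) (at x)" for x
    using DERIV_add[OF DERIV_chain2[OF ellip_F_has_derivative DERIV_minus[OF DERIV_ident]]
      ellip_F_has_derivative, of x] by simp
  from DERIV_isconst_all[OF allI[OF this], of x 0] show ?thesis by simp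
qed

lemma ellip_F_add_pi: "ellip_F k (x + pi) = ellip_F k x + 2 * ellip_F k (pi / 2)"
proof -
  have "((\<lambda>x. ellip_F k (x + pi) - ellip_F k x) has_real_derivative 0) (at x)" for x
  proof -
    have "((\<lambda>x. ellip_F k (x + pi)) has_real_derivative 1 / sqrt (1 - k\<^sup>2 * (sin x)\<^sup>2)) (at x)"
      using ellip_F_has_derivative[of "x + pi"] by (simp add: DERIV_shift)
    from DERIV_diff[OF this ellip_F_has_derivative] show ?thesis by simp
  qed
  \<comment> \<open>The constant is read off at -pi/2, where oddness of F turns the difference into
    2 F(k, pi/2).\<close>
  from DERIV_isconst_all[OF allI[OF this], of x "- pi / 2"] show ?thesis
    using ellip_F_minus[of "pi / 2"] by (simp add: algebra_simps)
qed

text \<open>Substitution t = sin x. The integrand of K is unbounded at t = 1, so the rule for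
  nonnegative integrands on open intervals is applied, with one-sided limits of the sine at the
  endpoints.\<close>

lemma ellip_K_eq: "ellip_K k = ellip_F k (pi / 2)"
proof -
  let ?f = "\<lambda>t. 1 / sqrt ((1 - t\<^sup>2) * (1 - k\<^sup>2 * t\<^sup>2))"
  let ?h = "\<lambda>x. 1 / sqrt (1 - k\<^sup>2 * (sin x)\<^sup>2)"
  have eq: "?f (sin x) * cos x = ?h x" if "0 < x" "x < pi / 2" for x
  proof -
    have "cos x > 0" using that by (intro cos_gt_zero_pi) auto
    then show ?thesis
      by (simp add: cos_squared_eq[symmetric] real_sqrt_mult)
  qed
  have cont: "continuous_on A ?h" for A
    using continuous_on_elliptic_powr[OF k, of A "- 1 / 2"]
    by (simp only: inverse_sqrt_powr[OF elliptic_radicand_pos[OF k]])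
  have "set_integrable lborel {0..pi / 2} ?h"
    using borel_integrable_atLeastAtMost'[OF cont] .
  then have "set_integrable lborel (einterval (ereal 0) (ereal (pi / 2))) ?h"
    by (rule set_integrable_subset) (auto simp: einterval_iff)
  then have int: "set_integrable lborel (einterval (ereal 0) (ereal (pi / 2))) (\<lambda>x. ?f (sin x) * cos x)"
    by (subst set_integrable_cong[OF refl refl eq]) (simp_all add: einterval_iff)
  have "(LBINT t=ereal 0..ereal 1. ?f t) = (LBINT x=ereal 0..ereal (pi / 2). ?f (sin x) * cos x)"
  proof (rule interval_integral_substitution_nonneg(2)[where g = sin and g' = cos])
    show "set_integrable lborel (einterval (ereal 0) (ereal (pi / 2))) (\<lambda>x. ?f (sin x) * cos x)"
      by (rule int)
    show "isCont ?f (sin x)" if "ereal 0 < ereal x" "ereal x < ereal (pi / 2)" for x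
    proof -
      have "cos x > 0" using that by (intro cos_gt_zero_pi) auto
      then have "(1 - (sin x)\<^sup>2) * (1 - k\<^sup>2 * (sin x)\<^sup>2) > 0"
        using elliptic_radicand_pos[OF k, of x] by (simp add: cos_squared_eq[symmetric])
      then show ?thesis by (intro continuous_intros) auto
    qed
    show "0 \<le> ?f (sin x)" if "ereal 0 < ereal x" "ereal x < ereal (pi / 2)" for x
      using elliptic_radicand_pos[OF k, of x] by (simp add: abs_square_le_1)
    have "(sin \<longlongrightarrow> sin (0 :: real)) (at_right 0)"
      by (rule tendsto_sin[OF tendsto_ident_at])
    moreover have "(sin \<longlongrightarrow> sin (pi / 2)) (at_left (pi / 2))"
      by (rule tendsto_sin[OF tendsto_ident_at])
    ultimately show "((ereal \<circ> sin \<circ> real_of_ereal) \<longlongrightarrow> ereal 0) (at_right (ereal 0))"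
      "((ereal \<circ> sin \<circ> real_of_ereal) \<longlongrightarrow> ereal 1) (at_left (ereal (pi / 2)))"
      by (simp_all only: ereal_tendsto_simps sin_zero sin_pi_half)
  qed (auto intro: DERIV_sin cos_ge_zero)
  also have "\<dots> = (LBINT x=ereal 0..ereal (pi / 2). ?h x)"
    by (intro interval_integral_cong eq) (simp_all add: einterval_iff)
  finally show ?thesis
    unfolding ellip_K_def ellip_F_def by (simp add: zero_ereal_def one_ereal_def)
qed

lemma ellip_K_pos: "ellip_K k > 0"
  using strict_monoD[OF ellip_F_strict_mono, of 0 "pi / 2"] by (simp add: ellip_K_eq)

lemma jacobi_am_add_period: "jacobi_am k (u + 2 * ellip_K k) = jacobi_am k u + pi"
  using jacobi_am_ellip_F[of "jacobi_am k u + pi"]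
  by (simp add: ellip_F_add_pi ellip_F_jacobi_am ellip_K_eq)

lemma jacobi_am_0: "jacobi_am k 0 = 0"
  using jacobi_am_ellip_F[of 0] by simp

lemma jacobi_am_less_iff: "jacobi_am k u < jacobi_am k v \<longleftrightarrow> u < v"
  using strict_mono_less[OF ellip_F_strict_mono] ellip_F_jacobi_am by metis

lemma jacobi_am_continuous: "isCont (jacobi_am k) u"
proof -
  have "isCont (jacobi_am k) (ellip_F k (jacobi_am k u))"
    by (rule isCont_inverse_function[where d = 1]) (simp_all add: jacobi_am_ellip_F ellip_F_continuous)
  then show ?thesis by (simp add: ellip_F_jacobi_am)
qed

lemma jacobi_am_has_derivative:
  "(jacobi_am k has_real_derivative jacobi_dn k u) (at u)"
proof -
  have "(jacobi_am k has_real_derivative inverse (1 / sqrt (1 - k\<^sup>2 * (sin (jacobi_am k u))\<^sup>2))) (at u)"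
    using elliptic_integrand_ge_1[of "jacobi_am k u"]
    by (intro DERIV_inverse_function[where f = "ellip_F k" and a = "u - 1" and b = "u + 1"]
        ellip_F_has_derivative jacobi_am_continuous ellip_F_jacobi_am) auto
  then show ?thesis by (simp add: jacobi_dn_def)
qed

lemma jacobi_dn_pos: "jacobi_dn k u > 0"
  unfolding jacobi_dn_def using elliptic_radicand_pos[OF k] by simp

text \<open>The factor dn from differentiating the amplitude cancels the 1/dn from differentiating
  the square root.\<close>

lemma jacobi_dn_has_derivative:
  "(jacobi_dn k has_real_derivative - k\<^sup>2 * sin (jacobi_am k u) * cos (jacobi_am k u)) (at u)"
proof -
  define s where "s = sin (jacobi_am k u)"
  define c where "c = cos (jacobi_am k u)"
  have "((\<lambda>u. sin (jacobi_am k u)) has_real_derivative c * jacobi_dn k u) (at u)"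
    unfolding c_def by (rule DERIV_chain2[OF DERIV_sin jacobi_am_has_derivative])
  from DERIV_diff[OF DERIV_const[of 1] DERIV_cmult[OF DERIV_power[OF this, of 2], of "k\<^sup>2"]]
  have "((\<lambda>u. 1 - k\<^sup>2 * (sin (jacobi_am k u))\<^sup>2) has_real_derivative
      - (k\<^sup>2 * (2 * s * (c * jacobi_dn k u)))) (at u)"
    by (simp add: s_def mult_ac)
  from DERIV_chain2[OF DERIV_real_sqrt[OF elliptic_radicand_pos[OF k]] this]
  have "((\<lambda>u. sqrt (1 - k\<^sup>2 * (sin (jacobi_am k u))\<^sup>2)) has_real_derivative
      inverse (jacobi_dn k u) / 2 * - (k\<^sup>2 * (2 * s * (c * jacobi_dn k u)))) (at u)"
    by (simp only: jacobi_dn_def)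
  moreover have "inverse (jacobi_dn k u) / 2 * - (k\<^sup>2 * (2 * s * (c * jacobi_dn k u))) = - k\<^sup>2 * s * c"
    using jacobi_dn_pos[of u] by (simp add: field_simps)
  moreover have "jacobi_dn k = (\<lambda>u. sqrt (1 - k\<^sup>2 * (sin (jacobi_am k u))\<^sup>2))"
    by (auto simp: jacobi_dn_def)
  ultimately show ?thesis
    by (simp only: s_def c_def)
qed

lemma jacobi_dn_add_period: "jacobi_dn k (u + 2 * ellip_K k) = jacobi_dn k u"
  by (simp add: jacobi_dn_def jacobi_am_add_period)

text \<open>Over this range of u the amplitude runs through (0, pi), where the sine is positive.
  This is what excludes periods shorter than 2 K, as dn is 1 at 0.\<close>

lemma jacobi_dn_less_1:
  assumes "k \<noteq> 0" "0 < u" "u < 2 * ellip_K k"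
  shows "jacobi_dn k u < 1"
proof -
  have "0 < jacobi_am k u" "jacobi_am k u < pi"
    using assms jacobi_am_less_iff[of 0 u] jacobi_am_less_iff[of u "0 + 2 * ellip_K k"]
      jacobi_am_add_period[of 0] by (simp_all add: jacobi_am_0)
  then have "sin (jacobi_am k u) > 0"
    by (rule sin_gt_zero)
  then show ?thesis
    using assms(1) by (simp add: jacobi_dn_def)
qed

end

lemma jacobi_dn_0: "\<bar>k\<bar> < 1 \<Longrightarrow> jacobi_dn k 0 = 1"
  by (simp add: jacobi_dn_def jacobi_am_0)

section \<open>The modulus as a function of the wave speed\<close>

lemma ellip_K_eq_integral:
  "\<bar>k\<bar> < 1 \<Longrightarrow> ellip_K k = (LBINT t=0..pi / 2. (1 - k\<^sup>2 * (sin t)\<^sup>2) powr (- 1 / 2))"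
  by (simp add: ellip_K_eq ellip_F_eq_powr)

lemma ck_on_ellip_K: "ck_on n {-1<..<1} (\<lambda>k x. ellip_K k)"
proof -
  have "ck_on n {-1<..<1} (\<lambda>k x. ellip_F k (pi / 2))"
    by (rule ck_on_compose[OF _ ck_on_ellip_F ck_on_fst ck_on_const]) auto
  then show ?thesis
    by (rule ck_on_cong[rotated 2]) (auto simp: ellip_K_eq)
qed

lemma ellip_K_has_derivative:
  assumes "\<bar>k\<bar> < 1"
  shows "(ellip_K has_real_derivative
    (LBINT t=0..pi / 2. k * (sin t)\<^sup>2 * (1 - k\<^sup>2 * (sin t)\<^sup>2) powr (- 3 / 2))) (at k)"
proof -
  let ?S = "{-1<..<1 :: real}"
  have k: "k \<in> ?S" using assms by auto
  have "((\<lambda>k. LBINT t=0..pi / 2. (1 - k\<^sup>2 * (sin t)\<^sup>2) powr (- 1 / 2)) has_real_derivative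
    (LBINT t=0..pi / 2. k * (sin t)\<^sup>2 * (1 - k\<^sup>2 * (sin t)\<^sup>2) powr (- 3 / 2))) (at k)"
  proof (rule interval_integral_has_derivative_param[OF _ k])
    fix s x :: real assume s: "s \<in> ?S"
    have pos: "1 - s\<^sup>2 * (sin x)\<^sup>2 > 0"
      using s by (intro elliptic_radicand_pos) auto
    have "((\<lambda>s. 1 - s\<^sup>2 * (sin x)\<^sup>2) has_real_derivative - (2 * s * (sin x)\<^sup>2)) (at s)"
      by (auto intro!: derivative_eq_intros)
    from DERIV_chain2[OF has_real_derivative_powr[OF pos] this, of "- 1 / 2"]
    show "((\<lambda>s. (1 - s\<^sup>2 * (sin x)\<^sup>2) powr (- 1 / 2)) has_real_derivative
        s * (sin x)\<^sup>2 * (1 - s\<^sup>2 * (sin x)\<^sup>2) powr (- 3 / 2)) (at s)"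
      by (simp add: mult_ac)
  next
    show "continuous_on (?S \<times> UNIV) (\<lambda>(k, x). (1 - k\<^sup>2 * (sin x)\<^sup>2) powr (- 1 / 2))"
      using ck_on_continuous[OF ck_on_elliptic_powr] .
    have "continuous_on (?S \<times> UNIV) (\<lambda>p. fst p * (sin (snd p))\<^sup>2 *
        (\<lambda>(k, x). (1 - k\<^sup>2 * (sin x)\<^sup>2) powr (- 3 / 2)) p)"
      by (intro continuous_intros ck_on_continuous[OF ck_on_elliptic_powr])
    then show "continuous_on (?S \<times> UNIV)
        (\<lambda>(k, x). k * (sin x)\<^sup>2 * (1 - k\<^sup>2 * (sin x)\<^sup>2) powr (- 3 / 2))"
      by (simp add: split_def)
  qed auto
  then show ?thesis
    by (rule has_field_derivative_transform_within_open[where S = ?S])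
       (use k in \<open>auto simp: ellip_K_eq_integral\<close>)
qed

text \<open>The difference of the two sides is \<open>k\<close> times the integral of \<open>D t * w t\<close> with
  \<open>D = 2 sin\<^sup>2 - 1\<close> of mean zero. Subtracting from \<open>w\<close> its value \<open>w0\<close> at the zero of
  \<open>D\<close> leaves the integral unchanged and makes the integrand nonnegative.\<close>

lemma ellip_K_deriv_gt:
  assumes "0 < k" "k < 1"
  shows "(2 - k\<^sup>2) * (LBINT t=0..pi / 2. k * (sin t)\<^sup>2 * (1 - k\<^sup>2 * (sin t)\<^sup>2) powr (- 3 / 2))
    > k * ellip_K k"
proof -
  have k: "\<bar>k\<bar> < 1" using assms by auto
  define r where "r t = 1 - k\<^sup>2 * (sin t)\<^sup>2" for t
  define w where "w t = r t powr (- 3 / 2)" for t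
  define w0 where "w0 = (1 - k\<^sup>2 / 2) powr (- 3 / 2)"
  define D where "D t = 2 * (sin t)\<^sup>2 - 1" for t :: real
  let ?I = "{0..pi / 2}"
  have r_pos: "r t > 0" for t
    using elliptic_radicand_pos[OF k] by (simp add: r_def)
  have half: "r t powr (- 1 / 2) = r t * w t" for t
    using r_pos[of t] powr_add[of "r t" 1 "- 3 / 2"] by (simp add: w_def)
  have contw: "continuous_on A w" for A
    unfolding w_def r_def by (rule continuous_on_elliptic_powr[OF k])
  have contD: "continuous_on A D" for A
    unfolding D_def by (intro continuous_intros)
  have conv: "(LBINT t=0..pi / 2. g t) = integral ?I g" if "continuous_on ?I g" for g :: "real \<Rightarrow> real"
    using interval_integral_eq_integral[of 0 "pi / 2" g] borel_integrable_atLeastAtMost'[OF that]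
    by (simp add: zero_ereal_def)
  have intD: "(D has_integral 0) ?I"
  proof -
    \<comment> \<open>The antiderivative - sin t cos t vanishes at both ends.\<close>
    have "(D has_integral (- (sin (pi / 2) * cos (pi / 2)) - (- (sin 0 * cos 0)))) ?I"
    proof (rule fundamental_theorem_of_calculus)
      fix t :: real
      have "((\<lambda>t. - (sin t * cos t)) has_real_derivative - (cos t * cos t + (- sin t) * sin t)) (at t within ?I)"
        by (intro DERIV_minus DERIV_mult has_field_derivative_at_within[OF DERIV_sin]
            has_field_derivative_at_within[OF DERIV_cos])
      moreover have "- (cos t * cos t + (- sin t) * sin t) = D t"
        using sin_cos_squared_add[of t] by (simp add: D_def power2_eq_square)
      ultimately show "((\<lambda>t. - (sin t * cos t)) has_vector_derivative D t) (at t within ?I)"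
        by (simp add: has_real_derivative_iff_has_vector_derivative)
    qed simp
    then show ?thesis by simp
  qed
  define g where "g t = D t * (w t - w0)" for t
  have contg: "continuous_on ?I g"
    unfolding g_def by (intro continuous_intros contw contD)
  have g_nonneg: "g t \<ge> 0" for t
  proof (cases "(sin t)\<^sup>2 \<ge> 1 / 2")
    case True
    then have "r t \<le> 1 - k\<^sup>2 / 2"
      using mult_left_mono[of "1 / 2" "(sin t)\<^sup>2" "k\<^sup>2"] by (simp add: r_def)
    then have "w t \<ge> w0"
      unfolding w_def w0_def using r_pos by (intro powr_mono2') auto
    then show ?thesis using True by (simp add: g_def D_def)
  next
    case False
    then have "1 - k\<^sup>2 / 2 \<le> r t"
      using mult_left_mono[of "(sin t)\<^sup>2" "1 / 2" "k\<^sup>2"] by (simp add: r_def)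
    moreover have "1 - k\<^sup>2 / 2 > 0"
      using k abs_square_less_1[of k] by simp
    ultimately have "w t \<le> w0"
      unfolding w_def w0_def by (intro powr_mono2') auto
    then show ?thesis using False by (simp add: g_def D_def mult_nonpos_nonpos)
  qed
  \<comment> \<open>Strictness: a continuous nonnegative function with a positive value has a
    nonzero integral.\<close>
  have "g (pi / 2) > 0"
  proof -
    have "k\<^sup>2 < 1" using k by (simp add: abs_square_less_1)
    then have "w (pi / 2) > w0"
      unfolding w_def w0_def r_def using assms(1)
      by (intro powr_less_mono2_neg) auto
    then show ?thesis by (simp add: g_def D_def)
  qed
  then have "integral ?I g \<noteq> 0"
    using integral_eq_0_iff[OF contg] g_nonneg by (auto simp: less_le)
  moreover have "integral ?I g \<ge> 0"
    using g_nonneg by (intro integral_nonneg integrable_continuous_real contg) auto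
  moreover have "integral ?I g = integral ?I (\<lambda>t. D t * w t)"
  proof -
    have "((\<lambda>t. D t * w t - D t * w0) has_integral integral ?I (\<lambda>t. D t * w t) - 0 * w0) ?I"
      by (intro has_integral_diff has_integral_mult_left intD integrable_integral
          integrable_continuous_real continuous_intros contD contw)
    then have "(g has_integral integral ?I (\<lambda>t. D t * w t)) ?I"
      by (simp add: g_def[abs_def] right_diff_distrib)
    then show ?thesis by (rule integral_unique)
  qed
  ultimately have J: "integral ?I (\<lambda>t. D t * w t) > 0" by simp
  have contr: "continuous_on A r" for A
    unfolding r_def by (intro continuous_intros)
  have I1: "((\<lambda>t. k * (sin t)\<^sup>2 * w t) has_integral integral ?I (\<lambda>t. k * (sin t)\<^sup>2 * w t)) ?I"
    by (intro integrable_integral integrable_continuous_real continuous_intros contw)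
  have I2: "((\<lambda>t. r t * w t) has_integral integral ?I (\<lambda>t. r t * w t)) ?I"
    by (intro integrable_integral integrable_continuous_real continuous_intros contw contr)
  have I3: "((\<lambda>t. D t * w t) has_integral integral ?I (\<lambda>t. D t * w t)) ?I"
    by (intro integrable_integral integrable_continuous_real continuous_intros contw contD)
  \<comment> \<open>With the integrand of K written as \<open>r t * w t\<close>, the k^2 terms
    cancel: (2 - k^2) sin^2 - (1 - k^2 sin^2) = 2 sin^2 - 1.\<close>
  have "(\<lambda>t. (2 - k\<^sup>2) * (k * (sin t)\<^sup>2 * w t) - k * (r t * w t)) = (\<lambda>t. k * (D t * w t))"
    by (simp add: fun_eq_iff D_def r_def algebra_simps)
  with has_integral_diff[OF has_integral_mult_right[OF I1, of "2 - k\<^sup>2"] has_integral_mult_right[OF I2, of k]]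
  have "((\<lambda>t. k * (D t * w t)) has_integral (2 - k\<^sup>2) * integral ?I (\<lambda>t. k * (sin t)\<^sup>2 * w t)
      - k * integral ?I (\<lambda>t. r t * w t)) ?I"
    by (simp only:)
  from has_integral_unique[OF this has_integral_mult_right[OF I3]]
  have *: "(2 - k\<^sup>2) * integral ?I (\<lambda>t. k * (sin t)\<^sup>2 * w t) - k * integral ?I (\<lambda>t. r t * w t)
      = k * integral ?I (\<lambda>t. D t * w t)" .
  have "(\<lambda>t. (1 - k\<^sup>2 * (sin t)\<^sup>2) powr (- 1 / 2)) = (\<lambda>t. r t * w t)"
    using half by (simp add: r_def)
  then have "ellip_K k = (LBINT t=0..pi / 2. r t * w t)"
    unfolding ellip_K_eq_integral[OF k] by (simp only:)
  also have "\<dots> = integral ?I (\<lambda>t. r t * w t)"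
    by (intro conv continuous_intros contr contw)
  finally have "ellip_K k = integral ?I (\<lambda>t. r t * w t)" .
  moreover have "(LBINT t=0..pi / 2. k * (sin t)\<^sup>2 * (1 - k\<^sup>2 * (sin t)\<^sup>2) powr (- 3 / 2)) =
      integral ?I (\<lambda>t. k * (sin t)\<^sup>2 * w t)"
    unfolding r_def[symmetric] w_def[symmetric]
    by (intro conv continuous_intros contw)
  ultimately show ?thesis
    using * mult_pos_pos[OF assms(1) J] by simp
qed

lemma ellip_K_0: "ellip_K 0 = pi / 2"
  unfolding ellip_K_eq_integral[of 0, simplified]
  using interval_integral_FTC_finite[of 0 "pi / 2" "\<lambda>x. 1 :: real" "\<lambda>x. x"]
  by (simp add: zero_ereal_def)

text \<open>With \<open>q\<close> the complementary modulus, the integrand is at least \<open>1 / (\<pi> / 2 - t + q)\<close>,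
  whence \<open>K \<ge> - ln q\<close>.\<close>

lemma ellip_K_unbounded:
  assumes "M > 0"
  obtains k where "0 < k" "k < 1" "ellip_K k \<ge> M"
proof -
  define q where "q = exp (- M)"
  have q: "0 < q" "q < 1" using assms by (auto simp: q_def)
  then have q2: "q\<^sup>2 < 1" by (simp add: power_less_one_iff)
  define k where "k = sqrt (1 - q\<^sup>2)"
  have k2: "k\<^sup>2 = 1 - q\<^sup>2" using q2 by (simp add: k_def)
  have k: "0 < k" "k < 1" using q q2 by (auto simp: k_def)
  then have k': "\<bar>k\<bar> < 1" by simp
  \<comment> \<open>Once G is known to increase, comparing its endpoint values gives K + ln q \<ge>
    ln (pi/2 + q) \<ge> 0, and - ln q = M by the choice of q.\<close>
  let ?G = "\<lambda>t. ellip_F k t + ln (pi / 2 - t + q)"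
  have "?G 0 \<le> ?G (pi / 2)"
  proof (rule DERIV_nonneg_imp_nondecreasing[where f = ?G])
    fix t :: real assume t: "0 \<le> t" "t \<le> pi / 2"
    have pos: "pi / 2 - t + q > 0" using t q by simp
    have "1 - k\<^sup>2 * (sin t)\<^sup>2 = (cos t)\<^sup>2 + q\<^sup>2 * (sin t)\<^sup>2"
      by (simp add: k2 cos_squared_eq algebra_simps)
    also have "\<dots> \<le> (cos t)\<^sup>2 + q\<^sup>2"
      using mult_left_mono[of "(sin t)\<^sup>2" 1 "q\<^sup>2"] by (simp add: abs_square_le_1)
    also have "\<dots> \<le> (cos t + q)\<^sup>2"
      using cos_ge_zero[of t] t q by (simp add: power2_sum)
    \<comment> \<open>Here cos t = sin (pi/2 - t) is at most pi/2 - t.\<close>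
    also have "\<dots> \<le> (pi / 2 - t + q)\<^sup>2"
      using sin_x_le_x[of "pi / 2 - t"] t cos_ge_zero[of t] q
      by (intro power_mono) (auto simp: sin_diff)
    finally have "sqrt (1 - k\<^sup>2 * (sin t)\<^sup>2) \<le> pi / 2 - t + q"
      using pos by (simp add: real_le_lsqrt)
    then have "1 / sqrt (1 - k\<^sup>2 * (sin t)\<^sup>2) - 1 / (pi / 2 - t + q) \<ge> 0"
      using elliptic_radicand_pos[OF k', of t] by (simp add: frac_le)
    moreover have "(?G has_real_derivative 1 / sqrt (1 - k\<^sup>2 * (sin t)\<^sup>2) + 1 / (pi / 2 - t + q) * (- 1)) (at t)"
      using pos by (intro DERIV_add ellip_F_has_derivative[OF k'] DERIV_chain2[OF DERIV_ln_divide])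
        (auto intro!: derivative_eq_intros)
    ultimately show "\<exists>y. (?G has_real_derivative y) (at t) \<and> 0 \<le> y"
      by (intro exI[of _ "1 / sqrt (1 - k\<^sup>2 * (sin t)\<^sup>2) + 1 / (pi / 2 - t + q) * (- 1)"]) simp
  qed simp
  moreover have "ln (pi / 2 + q) \<ge> 0"
    using q pi_ge_two by (intro ln_ge_zero) simp
  ultimately have "ellip_K k \<ge> M"
    using ellip_F_0[OF k'] by (simp add: ellip_K_eq[OF k'] q_def)
  with k show ?thesis by (rule that)
qed

section \<open>The speed as a function of the modulus, and its inverse\<close>

definition speed_of_modulus :: "real \<Rightarrow> real \<Rightarrow> real" where
  "speed_of_modulus L k = 2 * (ellip_K k)\<^sup>2 / L\<^sup>2 * (2 - k\<^sup>2)"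

lemma is_modulus_iff: "is_modulus L c k \<longleftrightarrow> 0 < k \<and> k < 1 \<and> c = speed_of_modulus L k"
  by (simp add: is_modulus_def speed_of_modulus_def)

lemma ck_on_speed_of_modulus: "ck_on n {-1<..<1} (\<lambda>k x. speed_of_modulus L k)"
proof -
  have "ck_on n {-1<..<1} (\<lambda>k x. (2 / L\<^sup>2) * (ellip_K k * ellip_K k) * (2 + (- 1) * (k * k)))"
    by (intro ck_on_mult ck_on_add ck_on_const ck_on_fst ck_on_ellip_K)
  then show ?thesis
    by (simp add: speed_of_modulus_def power2_eq_square)
qed

lemma continuous_on_speed_of_modulus: "continuous_on {-1<..<1} (speed_of_modulus L)"
proof -
  have "continuous_on {-1<..<1} (\<lambda>k. (\<lambda>(k, x). speed_of_modulus L k) (k, 0 :: real))"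
    by (rule continuous_on_compose2[OF ck_on_continuous[OF ck_on_speed_of_modulus[of 0]]])
       (auto intro!: continuous_intros)
  then show ?thesis by simp
qed

lemma speed_of_modulus_has_derivative_pos:
  assumes "L > 0" "0 < k" "k < 1"
  shows "\<exists>d>0. (speed_of_modulus L has_real_derivative d) (at k)"
proof -
  have k: "\<bar>k\<bar> < 1" using assms by simp
  obtain K' where K': "(ellip_K has_real_derivative K') (at k)" "(2 - k\<^sup>2) * K' > k * ellip_K k"
    using ellip_K_has_derivative[OF k] ellip_K_deriv_gt[OF assms(2,3)] by blast
  let ?d = "2 * (2 * ellip_K k * K') / L\<^sup>2 * (2 - k\<^sup>2) + (- (2 * k)) * (2 * (ellip_K k)\<^sup>2 / L\<^sup>2)"
  have "((\<lambda>k. 2 * (ellip_K k)\<^sup>2 / L\<^sup>2) has_real_derivative 2 * (2 * ellip_K k * K') / L\<^sup>2) (at k)"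
    using DERIV_cdivide[OF DERIV_cmult[OF DERIV_power[OF K'(1), of 2], of 2], of "L\<^sup>2"]
    by (simp add: mult_ac)
  moreover have "((\<lambda>k. 2 - k\<^sup>2) has_real_derivative - (2 * k)) (at k)"
    by (auto intro!: derivative_eq_intros)
  ultimately have "((\<lambda>k. 2 * (ellip_K k)\<^sup>2 / L\<^sup>2 * (2 - k\<^sup>2)) has_real_derivative ?d) (at k)"
    by (rule DERIV_mult)
  then have "(speed_of_modulus L has_real_derivative ?d) (at k)"
    by (simp add: speed_of_modulus_def[abs_def])
  moreover have "?d = 4 * ellip_K k / L\<^sup>2 * ((2 - k\<^sup>2) * K' - k * ellip_K k)"
    using assms(1) by (simp add: field_simps power2_eq_square)
  then have "?d > 0"
    using K'(2) ellip_K_pos[OF k] assms(1) by simp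
  ultimately show ?thesis by blast
qed

text \<open>The speed is even in k, so its derivative vanishes at k = 0. To include this endpoint,
  positivity of the derivative in the interior is combined with continuity on the closed
  interval.\<close>

lemma speed_of_modulus_strict_mono:
  assumes "L > 0" "0 \<le> k" "k < l" "l < 1"
  shows "speed_of_modulus L k < speed_of_modulus L l"
proof (rule DERIV_pos_imp_increasing_open[OF assms(3)])
  fix x assume "k < x" "x < l"
  then show "\<exists>d. (speed_of_modulus L has_real_derivative d) (at x) \<and> 0 < d"
    using speed_of_modulus_has_derivative_pos[OF assms(1), of x] assms by auto
next
  show "continuous_on {k..l} (speed_of_modulus L)"
    using assms by (intro continuous_on_subset[OF continuous_on_speed_of_modulus]) auto
qed

lemma speed_of_modulus_0: "speed_of_modulus L 0 = pi\<^sup>2 / L\<^sup>2"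
  by (simp add: speed_of_modulus_def ellip_K_0 power2_eq_square)

lemma speed_of_modulus_gt: "L > 0 \<Longrightarrow> 0 < k \<Longrightarrow> k < 1 \<Longrightarrow> speed_of_modulus L k > pi\<^sup>2 / L\<^sup>2"
  using speed_of_modulus_strict_mono[of L 0 k] by (simp add: speed_of_modulus_0)

lemma ex1_modulus:
  assumes "L > 0" "c > pi\<^sup>2 / L\<^sup>2"
  shows "\<exists>!k. is_modulus L c k"
proof -
  have "0 \<le> pi\<^sup>2 / L\<^sup>2" by simp
  then have "c > 0" using assms(2) by linarith
  \<comment> \<open>Chosen so that 2 M^2 / L^2 = c. As 2 - l^2 \<ge> 1, a modulus l with K(l) \<ge>
    M has speed at least c, and the intermediate value theorem applies on [0, l].\<close>
  define M where "M = sqrt (c * L\<^sup>2 / 2)"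
  have "M > 0" using \<open>c > 0\<close> assms(1) by (simp add: M_def)
  obtain l where l: "0 < l" "l < 1" "ellip_K l \<ge> M"
    using ellip_K_unbounded[OF \<open>M > 0\<close>] by blast
  have "c = 2 * M\<^sup>2 / L\<^sup>2 * 1"
    using \<open>c > 0\<close> assms(1) by (simp add: M_def)
  also have "\<dots> \<le> 2 * (ellip_K l)\<^sup>2 / L\<^sup>2 * (2 - l\<^sup>2)"
  proof (rule mult_mono)
    show "2 * M\<^sup>2 / L\<^sup>2 \<le> 2 * (ellip_K l)\<^sup>2 / L\<^sup>2"
      using l(3) \<open>M > 0\<close> by (intro divide_right_mono mult_left_mono power_mono) simp_all
    show "1 \<le> 2 - l\<^sup>2"
      using power_le_one[of l 2] l by simp
  qed simp_all
  also have "\<dots> = speed_of_modulus L l"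
    by (simp add: speed_of_modulus_def)
  finally have "c \<le> speed_of_modulus L l" .
  moreover have "continuous_on {0..l} (speed_of_modulus L)"
    by (rule continuous_on_subset[OF continuous_on_speed_of_modulus]) (use l in auto)
  ultimately have "\<exists>k\<ge>0. k \<le> l \<and> speed_of_modulus L k = c"
    using l assms(2) by (intro IVT'[of "speed_of_modulus L" 0 c l]) (simp_all add: speed_of_modulus_0)
  then obtain k where k: "0 \<le> k" "k \<le> l" "speed_of_modulus L k = c"
    by blast
  then have "k \<noteq> 0" using assms(2) by (auto simp: speed_of_modulus_0)
  then have "is_modulus L c k" using k l by (simp add: is_modulus_iff)
  moreover have "k' = k" if "is_modulus L c k'" for k'
  proof (rule ccontr)
    assume "k' \<noteq> k"
    then consider "k' < k" | "k < k'" by linarith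
    then show False
      using that \<open>is_modulus L c k\<close> speed_of_modulus_strict_mono[OF assms(1), of k k']
        speed_of_modulus_strict_mono[OF assms(1), of k' k]
      by cases (simp_all add: is_modulus_iff)
  qed
  ultimately show ?thesis by blast
qed

lemma
  assumes "L > 0" "c > pi\<^sup>2 / L\<^sup>2"
  shows modulus_pos: "0 < modulus L c"
    and modulus_less_1: "modulus L c < 1"
    and speed_of_modulus_modulus: "speed_of_modulus L (modulus L c) = c"
proof -
  have "is_modulus L c (modulus L c)"
    using theI'[OF ex1_modulus[OF assms]] by (simp only: modulus_def)
  then show "0 < modulus L c" "modulus L c < 1" "speed_of_modulus L (modulus L c) = c"
    by (simp_all add: is_modulus_iff)
qed

lemma modulus_speed_of_modulus:
  assumes "L > 0" "0 < k" "k < 1"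
  shows "modulus L (speed_of_modulus L k) = k"
  unfolding modulus_def
  by (rule the1_equality[OF ex1_modulus[OF assms(1) speed_of_modulus_gt[OF assms]]])
     (simp add: is_modulus_iff assms)

text \<open>Inverse function theorem on (0, 1), where \<open>modulus L\<close> is a left inverse of
  the speed. The derivative \<open>d\<close> is left arbitrary so that witnesses supplied by
  \<open>ck_on\<close> also fit.\<close>

lemma modulus_has_derivative:
  assumes "L > 0" "c > pi\<^sup>2 / L\<^sup>2"
    and d: "(speed_of_modulus L has_real_derivative d) (at (modulus L c))" "d \<noteq> 0"
  shows "(modulus L has_real_derivative inverse d) (at c)"
proof -
  have "(modulus L has_derivative (*) (inverse d)) (at (speed_of_modulus L (modulus L c)))"
  proof (rule has_derivative_inverse_strong[where S = "{0<..<1}" and f = "speed_of_modulus L"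
        and x = "modulus L c"])
    show "(speed_of_modulus L has_derivative (*) d) (at (modulus L c))"
      by (rule d(1)[unfolded has_field_derivative_def])
    show "continuous_on {0<..<1} (speed_of_modulus L)"
      by (rule continuous_on_subset[OF continuous_on_speed_of_modulus]) auto
    show "(*) d \<circ> (*) (inverse d) = id"
      using d(2) by (simp add: fun_eq_iff)
    show "modulus L c \<in> {0<..<1}"
      using modulus_pos[OF assms(1,2)] modulus_less_1[OF assms(1,2)] by simp
    show "modulus L (speed_of_modulus L k) = k" if "k \<in> {0<..<1}" for k
      using that by (simp add: modulus_speed_of_modulus[OF assms(1)])
  qed simp
  then show ?thesis
    unfolding has_field_derivative_def speed_of_modulus_modulus[OF assms(1,2)] .
qed

text \<open>Bootstrap: k'(c) is the reciprocal of dc/dk at k(c), so smoothness of order n of the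
  modulus passes to its derivative and gives order n + 1.\<close>

lemma ck_on_modulus:
  assumes "L > 0"
  shows "ck_on n {pi\<^sup>2 / L\<^sup>2<..} (\<lambda>c x. modulus L c)"
proof (induction n)
  have cont: "continuous_on {pi\<^sup>2 / L\<^sup>2<..} (modulus L)"
  proof (intro continuous_at_imp_continuous_on ballI)
    fix c assume "c \<in> {pi\<^sup>2 / L\<^sup>2<..}"
    then have c: "c > pi\<^sup>2 / L\<^sup>2" by simp
    obtain d where "d > 0" and d: "(speed_of_modulus L has_real_derivative d) (at (modulus L c))"
      using speed_of_modulus_has_derivative_pos[OF assms modulus_pos[OF assms c] modulus_less_1[OF assms c]]
      by blast
    then have "d \<noteq> 0" by linarith
    then show "isCont (modulus L) c"
      by (rule DERIV_isCont[OF modulus_has_derivative[OF assms c d]])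
  qed
  have cont2: "continuous_on ({pi\<^sup>2 / L\<^sup>2<..} \<times> UNIV) (\<lambda>(c, x :: real). modulus L c)"
    unfolding split_def by (intro continuous_on_compose2[OF cont] continuous_intros) auto
  {
    case 0
    then show ?case using cont2 by simp
  next
    case (Suc n)
    obtain f1 f2 where f:
      "\<And>k x. k \<in> {-1<..<1} \<Longrightarrow> (speed_of_modulus L has_real_derivative f1 k x) (at k)"
      "ck_on n {-1<..<1} f1"
      using ck_on_speed_of_modulus[of "Suc n" L] by (rule ck_on_SucE) blast
    have mod: "modulus L c \<in> {-1<..<1}" if "c \<in> {pi\<^sup>2 / L\<^sup>2<..}" for c
      using that modulus_pos[OF assms, of c] modulus_less_1[OF assms, of c] by simp
    have f1_pos: "f1 (modulus L c) x > 0" if c: "c \<in> {pi\<^sup>2 / L\<^sup>2<..}" for c x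
    proof -
      obtain d where "d > 0" and d: "(speed_of_modulus L has_real_derivative d) (at (modulus L c))"
        using c speed_of_modulus_has_derivative_pos[OF assms modulus_pos[OF assms] modulus_less_1[OF assms]]
        by (metis greaterThan_iff)
      then show ?thesis
        using DERIV_unique[OF d f(1)[OF mod[OF c], of x]] by simp
    qed
    show ?case
    proof (rule ck_on_SucI[OF cont2])
      show "ck_on n {pi\<^sup>2 / L\<^sup>2<..} (\<lambda>c x. 1 / f1 (modulus L c) x)"
        by (rule ck_on_inverse[OF ck_on_compose[OF _ f(2) Suc ck_on_snd mod] f1_pos]) simp
      show "((\<lambda>c. modulus L c) has_real_derivative 1 / f1 (modulus L c) x) (at c)"
        if c: "c \<in> {pi\<^sup>2 / L\<^sup>2<..}" for c x
      proof -
        have "f1 (modulus L c) x \<noteq> 0"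
          using f1_pos[OF c, of x] by linarith
        from modulus_has_derivative[OF assms _ f(1)[OF mod[OF c]] this] c show ?thesis
          by (simp add: inverse_eq_divide)
      qed
    qed (rule DERIV_const ck_on_const)+
  }
qed

section \<open>The wave profile\<close>

text \<open>Taking k as the parameter separates the smooth dependence of the profile on k from the
  dependence of k on c.\<close>

definition wave_of_modulus :: "real \<Rightarrow> real \<Rightarrow> real \<Rightarrow> real" where
  "wave_of_modulus L k x = 2 * ellip_K k / L * jacobi_dn k (2 * ellip_K k / L * x)"

lemma dnoidal_eq_wave_of_modulus: "dnoidal L c x = wave_of_modulus L (modulus L c) x"
  by (simp add: dnoidal_def dnoidal_eta_def wave_of_modulus_def)

lemma ck_on_wave_of_modulus:
  assumes "L > 0"
  shows "ck_on n {-1<..<1} (wave_of_modulus L)"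
proof -
  let ?S = "{-1<..<1 :: real}"
  define A where "A k x = jacobi_am k (2 * ellip_K k / L * x)" for k x
  \<comment> \<open>F rescaled by 1 / \<eta> = L / (2 K), so that the rescaled amplitude
    \<open>A\<close> solves H k a = x exactly, as the implicit function lemma requires.\<close>
  define H where "H k a = ellip_F k a * (L * (1 / (2 * ellip_K k)))" for k a
  have S: "\<bar>k\<bar> < 1" if "k \<in> ?S" for k using that by auto
  have ckH: "ck_on n ?S H" for n
    unfolding H_def using ellip_K_pos[OF S]
    by (intro ck_on_mult ck_on_ellip_F ck_on_const ck_on_inverse ck_on_ellip_K) auto
  have ckA: "ck_on n ?S A"
  proof (rule ck_on_implicit[OF _ ckH])
    fix k assume k: "k \<in> ?S"
    have pos: "L * (1 / (2 * ellip_K k)) > 0"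
      using assms ellip_K_pos[OF S[OF k]] by simp
    show "strict_mono (H k)"
      using strict_monoD[OF ellip_F_strict_mono[OF S[OF k]]] pos
      unfolding H_def by (intro strict_monoI mult_strict_right_mono)
    show "H k (A k x) = x" for x
      using assms ellip_K_pos[OF S[OF k]] by (simp add: H_def A_def ellip_F_jacobi_am[OF S[OF k]])
    show "(H k has_real_derivative 1 / sqrt (1 - k\<^sup>2 * (sin x)\<^sup>2) * (L * (1 / (2 * ellip_K k)))) (at x)" for x
      using DERIV_cmult_right[OF ellip_F_has_derivative[OF S[OF k]]] unfolding H_def[abs_def] .
    show "1 / sqrt (1 - k\<^sup>2 * (sin x)\<^sup>2) * (L * (1 / (2 * ellip_K k))) > 0" for x
      using pos less_le_trans[OF zero_less_one elliptic_integrand_ge_1[OF S[OF k]]]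
      by (rule mult_pos_pos[rotated])
  qed simp
  have "ck_on n ?S (\<lambda>k x. (2 / L) * ellip_K k * (1 - k\<^sup>2 * (sin (A k x))\<^sup>2) powr (1 / 2))"
    by (intro ck_on_mult ck_on_const ck_on_ellip_K ck_on_compose[OF _ ck_on_elliptic_powr ck_on_fst ckA]) auto
  then show ?thesis
  proof (rule ck_on_cong[rotated 2])
    fix k x assume "k \<in> ?S"
    then show "(2 / L) * ellip_K k * (1 - k\<^sup>2 * (sin (A k x))\<^sup>2) powr (1 / 2) = wave_of_modulus L k x"
      using elliptic_radicand_pos[OF S, of k "A k x"]
      by (simp add: wave_of_modulus_def jacobi_dn_def A_def powr_half_sqrt)
  qed simp
qed

lemma smooth_on_dnoidal:
  assumes "L > 0"
  shows "smooth_on {pi\<^sup>2 / L\<^sup>2<..} (dnoidal L)"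
proof -
  have "ck_on n {pi\<^sup>2 / L\<^sup>2<..} (\<lambda>c x. wave_of_modulus L (modulus L c) x)" for n
    by (rule ck_on_compose[OF _ ck_on_wave_of_modulus ck_on_modulus ck_on_snd])
       (use assms modulus_pos[OF assms] modulus_less_1[OF assms] in \<open>auto intro: less_trans[of "-1" 0]\<close>)
  then show ?thesis
    by (simp add: smooth_on_def dnoidal_eq_wave_of_modulus[abs_def])
qed

lemma wave_of_modulus_periodic:
  assumes "L > 0" "\<bar>k\<bar> < 1"
  shows "wave_of_modulus L k (x + L) = wave_of_modulus L k x"
proof -
  have "2 * ellip_K k / L * (x + L) = 2 * ellip_K k / L * x + 2 * ellip_K k"
    using assms(1) by (simp add: field_simps)
  then show ?thesis
    unfolding wave_of_modulus_def by (simp only: jacobi_dn_add_period[OF assms(2)])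
qed

text \<open>A period S < L would give dn the value 1 at 2 K S / L, which lies strictly between 0 and
  2 K, where dn < 1.\<close>

lemma fundamental_period_wave_of_modulus:
  assumes "L > 0" "0 < k" "k < 1"
  shows "fundamental_period (wave_of_modulus L k) L"
proof -
  have k: "\<bar>k\<bar> < 1" "k \<noteq> 0" using assms by auto
  have K: "ellip_K k > 0" by (rule ellip_K_pos[OF k(1)])
  have False if S: "0 < S" "S < L" "periodic_fun_simple (wave_of_modulus L k) S" for S
  proof -
    have "wave_of_modulus L k (0 + S) = wave_of_modulus L k 0"
      using S(3) unfolding periodic_fun_simple_def by blast
    then have "jacobi_dn k (2 * ellip_K k / L * S) = 1"
      using K assms(1) by (simp add: wave_of_modulus_def jacobi_dn_0[OF k(1)])
    moreover have "0 < 2 * ellip_K k / L * S" "2 * ellip_K k / L * S < 2 * ellip_K k"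
      using S K assms(1) by (auto simp: field_simps)
    ultimately show False
      using jacobi_dn_less_1[OF k] by fastforce
  qed
  then show ?thesis
    using assms(1) wave_of_modulus_periodic[OF assms(1) k(1)]
    unfolding fundamental_period_def periodic_fun_simple_def[of "wave_of_modulus L k" L] by blast
qed

text \<open>With 2 c = \<eta>^2 (2 - k^2), both sides are polynomials in the square of the sine of
  the amplitude. The constant can be read off at the crest x = 0, where the wave equals \<eta> and
  its derivative is 0: - \<eta>^4 + \<eta>^4 (2 - k^2) + 2 B = 0.\<close>

lemma wave_of_modulus_ode:
  assumes "L > 0" "0 < k" "k < 1"
  defines "\<eta> \<equiv> 2 * ellip_K k / L"
  shows "wave_of_modulus L k differentiable at x"
    and "(deriv (wave_of_modulus L k) x)\<^sup>2 = - (wave_of_modulus L k x ^ 4)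
      + 2 * speed_of_modulus L k * (wave_of_modulus L k x)\<^sup>2 + 2 * (- (\<eta> ^ 4 * (1 - k\<^sup>2) / 2))"
proof -
  have k: "\<bar>k\<bar> < 1" using assms by auto
  define s c where "s = sin (jacobi_am k (\<eta> * x))" and "c = cos (jacobi_am k (\<eta> * x))"
  have "((\<lambda>x. \<eta> * x) has_real_derivative \<eta>) (at x)"
    using DERIV_cmult_Id .
  from DERIV_cmult[OF DERIV_chain2[OF jacobi_dn_has_derivative[OF k] this], of \<eta>]
  have D: "(wave_of_modulus L k has_real_derivative \<eta> * (- k\<^sup>2 * s * c * \<eta>)) (at x)"
    by (simp only: wave_of_modulus_def[abs_def] \<eta>_def s_def c_def)
  then show "wave_of_modulus L k differentiable at x"
    unfolding real_differentiable_def by blast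
  have c2: "c\<^sup>2 = 1 - s\<^sup>2"
    by (simp add: s_def c_def cos_squared_eq)
  have w2: "(wave_of_modulus L k x)\<^sup>2 = \<eta>\<^sup>2 * (1 - k\<^sup>2 * s\<^sup>2)"
    using elliptic_radicand_pos[OF k, of "jacobi_am k (\<eta> * x)"]
    by (simp add: wave_of_modulus_def \<eta>_def[symmetric] jacobi_dn_def power_mult_distrib s_def)
  then have w4: "wave_of_modulus L k x ^ 4 = (\<eta>\<^sup>2 * (1 - k\<^sup>2 * s\<^sup>2))\<^sup>2"
    by (simp add: power2_eq_square power4_eq_xxxx)
  have sp: "2 * speed_of_modulus L k = \<eta>\<^sup>2 * (2 - k\<^sup>2)"
    by (simp add: speed_of_modulus_def \<eta>_def power_divide power_mult_distrib)
  have "(deriv (wave_of_modulus L k) x)\<^sup>2 = \<eta> ^ 4 * (k\<^sup>2)\<^sup>2 * s\<^sup>2 * c\<^sup>2"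
    unfolding DERIV_imp_deriv[OF D] by (simp add: power_mult_distrib power2_eq_square power4_eq_xxxx)
  also have "\<dots> = - ((\<eta>\<^sup>2 * (1 - k\<^sup>2 * s\<^sup>2))\<^sup>2) + \<eta>\<^sup>2 * (2 - k\<^sup>2) * (\<eta>\<^sup>2 * (1 - k\<^sup>2 * s\<^sup>2))
      + 2 * (- (\<eta> ^ 4 * (1 - k\<^sup>2) / 2))"
    unfolding c2 by (simp add: field_simps power2_eq_square power4_eq_xxxx)
  finally show "(deriv (wave_of_modulus L k) x)\<^sup>2 = - (wave_of_modulus L k x ^ 4)
      + 2 * speed_of_modulus L k * (wave_of_modulus L k x)\<^sup>2 + 2 * (- (\<eta> ^ 4 * (1 - k\<^sup>2) / 2))"
    unfolding w4 w2 sp .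
qed

text \<open>Unique existence of the modulus is stated as well, because \<open>modulus\<close> is a
  definite description and k(c) has its intended meaning only then.\<close>

theorem proposition1:
  fixes L :: real
  assumes "L > 0"
  shows "(\<forall>c>pi\<^sup>2 / L\<^sup>2.
            (\<exists>!k. is_modulus L c k) \<and>
            fundamental_period (dnoidal L c) L \<and>
            (\<exists>B::real. \<forall>x. dnoidal L c differentiable at x \<and>
               (deriv (dnoidal L c) x)\<^sup>2
                 = - ((dnoidal L c x) ^ 4) + 2 * c * (dnoidal L c x)\<^sup>2 + 2 * B)) \<and>
         (\<forall>n. smooth_into_Hper n L {pi\<^sup>2 / L\<^sup>2<..} (dnoidal L)) \<and>
         (\<forall>c>pi\<^sup>2 / L\<^sup>2. \<exists>d>0. (modulus L has_real_derivative d) (at c))"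
proof (intro conjI allI impI)
  fix c assume c: "c > pi\<^sup>2 / L\<^sup>2"
  note mod = modulus_pos[OF assms c] modulus_less_1[OF assms c]
  have eq: "dnoidal L c = wave_of_modulus L (modulus L c)"
    using dnoidal_eq_wave_of_modulus by blast
  show "\<exists>!k. is_modulus L c k"
    by (rule ex1_modulus[OF assms c])
  show "fundamental_period (dnoidal L c) L"
    unfolding eq by (rule fundamental_period_wave_of_modulus[OF assms mod])
  show "\<exists>B::real. \<forall>x. dnoidal L c differentiable at x \<and>
     (deriv (dnoidal L c) x)\<^sup>2 = - ((dnoidal L c x) ^ 4) + 2 * c * (dnoidal L c x)\<^sup>2 + 2 * B"
    unfolding eq
    using wave_of_modulus_ode[OF assms mod, unfolded speed_of_modulus_modulus[OF assms c]] by blast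
  obtain d where "d > 0" and d: "(speed_of_modulus L has_real_derivative d) (at (modulus L c))"
    using speed_of_modulus_has_derivative_pos[OF assms mod] by blast
  then have "d \<noteq> 0" "inverse d > 0" by simp_all
  then show "\<exists>d>0. (modulus L has_real_derivative d) (at c)"
    using modulus_has_derivative[OF assms c d] by blast
next
  fix n
  show "smooth_into_Hper n L {pi\<^sup>2 / L\<^sup>2<..} (dnoidal L)"
  proof (rule smooth_into_HperI[OF assms _ smooth_on_dnoidal[OF assms]])
    fix c x assume "c \<in> {pi\<^sup>2 / L\<^sup>2<..}"
    then have "\<bar>modulus L c\<bar> < 1"
      using modulus_pos[OF assms] modulus_less_1[OF assms] by force
    then show "dnoidal L c (x + L) = dnoidal L c x"
      by (simp add: dnoidal_eq_wave_of_modulus wave_of_modulus_periodic[OF assms])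
  qed simp
qed

end
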